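(* Let $\mathbf{PF}=\Bbbk\mathrm{PF}$ be the linearized species of parking functions. Then $\mathbf{PF}$ is a Hopf monoid in species under the product $\mu^{\mathbf{PF}}_{S,T}(\Phi\otimes\Psi)=\Phi|\Psi$ (concatenation) and the coproduct $\Delta^{\mathbf{PF}}_{S,T}(\Phi)=\mathsf{park}(\Phi_{\cap S})\otimes\mathsf{park}(\Phi_{\cap T})$.
   Context: Work over a field $\Bbbk$ of characteristic $0$; Hopf monoids are taken in the braided monoidal category of species (functors from finite sets with bijections to vector spaces) under the Cauchy product $(\mathbf p\cdot\mathbf q)[I]=\bigoplus_{S\sqcup T=I}\mathbf p[S]\otimes\mathbf q[T]$ (ordered decompositions, parts possibly empty), with unit species $\mathbf1$ and trivial braiding. A weak set composition of $I$ is a finite list $\Gamma=(A_1,\dots,A_k)$ of pairwise disjoint, possibly empty subsets with union $I$; its length is $\ell(\Gamma)=k$ and size $|\Gamma|=\sum_i|A_i|$. For $|I|=n$, a parking function on $I$ is a weak set composition $(A_1,\dots,A_n)$ of $I$ of length $n$ with $\sum_{i=1}^k|A_i|\ge k$ for all $1\le k\le n$; $\mathrm{PF}[I]$ is the set of these (with $\mathrm{PF}[\emptyset]=\{()\}$), and bijections act by relabelling. For $S\subseteq I$ and $\Phi=(A_1,\dots,A_n)$, $\Phi_{\cap S}=(A_1\cap S,\dots,A_n\cap S)$. $\Phi|\Psi$ is concatenation of lists. For a weak set composition $\Gamma=(B_1,\dots,B_k)$, $\mathsf{park}(\Gamma)$ is computed as follows: start with $\Phi=()$; for $i=1,\dots,k$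 in order, if $|\Phi|+|B_i|\ge\ell(\Phi)+1$ then append $B_i$ to $\Phi$, otherwise discard $B_i$; return $\Phi$. *)

theory Defs
  imports Complex_Main "HOL-Library.Function_Algebras" "HOL-Library.Poly_Mapping"
begin

section \<open>Vector spaces and tensor products\<close>

text \<open>
  A vector space is a subspace \<open>carr\<close> of an ambient type, whose vector space structure is given
  by its type class addition and an explicit scalar multiplication \<open>scal\<close>. This lets a species
  assign a different space to each finite set.
\<close>

record ('k, 'v) vs =
  scal :: "'k \<Rightarrow> 'v \<Rightarrow> 'v"
  carr :: "'v set"

definition vspace :: "('k::field, 'v::ab_group_add) vs \<Rightarrow> bool" where
  "vspace X \<longleftrightarrow> vector_space (scal X) \<and> module.subspace (scal X) (carr X)"

definition linear_map ::
    "('k::field, 'v::ab_group_add) vs \<Rightarrow> ('k, 'w::ab_group_add) vs \<Rightarrow> ('v \<Rightarrow> 'w) \<Rightarrow> bool" where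
  "linear_map X Y f \<longleftrightarrow>
     (\<forall>x\<in>carr X. f x \<in> carr Y) \<and>
     (\<forall>x\<in>carr X. \<forall>x'\<in>carr X. f (x + x') = f x + f x') \<and>
     (\<forall>c. \<forall>x\<in>carr X. f (scal X c x) = scal Y c (f x))"

definition base_field :: "('k::field, 'k) vs" where
  "base_field = \<lparr>scal = (*), carr = UNIV\<rparr>"

definition bilinear_map ::
    "('k::field, 'v::ab_group_add) vs \<Rightarrow> ('k, 'w::ab_group_add) vs \<Rightarrow> ('k, 'u::ab_group_add) vs \<Rightarrow>
     ('v \<Rightarrow> 'w \<Rightarrow> 'u) \<Rightarrow> bool" where
  "bilinear_map X Y Z b \<longleftrightarrow>
     (\<forall>y\<in>carr Y. linear_map X Z (\<lambda>x. b x y)) \<and> (\<forall>x\<in>carr X. linear_map Y Z (\<lambda>y. b x y))"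

abbreviation bilinear_form ::
    "('k::field, 'v::ab_group_add) vs \<Rightarrow> ('k, 'w::ab_group_add) vs \<Rightarrow> ('v \<Rightarrow> 'w \<Rightarrow> 'k) \<Rightarrow> bool" where
  "bilinear_form X Y \<equiv> bilinear_map X Y base_field"

text \<open>
  Over a field, the tensor product of \<open>X\<close> and \<open>Y\<close> embeds into the dual of the space of bilinear
  forms on \<open>X \<times> Y\<close>, with \<open>x \<otimes> y\<close> going to evaluation at \<open>(x, y)\<close>. We take the image of this
  embedding, i.e. the span of the evaluations, as the tensor product. Its universal property is
  proved below (\<open>tensor_universal\<close>, \<open>tensor_map_eqI\<close>).
\<close>

type_synonym ('k, 'v, 'w) tensor = "('v \<Rightarrow> 'w \<Rightarrow> 'k) \<Rightarrow> 'k"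

definition pure_tensor ::
    "('k::field, 'v::ab_group_add) vs \<Rightarrow> ('k, 'w::ab_group_add) vs \<Rightarrow> 'v \<Rightarrow> 'w \<Rightarrow> ('k, 'v, 'w) tensor" where
  "pure_tensor X Y x y = (\<lambda>B. if bilinear_form X Y B then B x y else 0)"

definition tensor_scale :: "'k::field \<Rightarrow> ('k, 'v, 'w) tensor \<Rightarrow> ('k, 'v, 'w) tensor" where
  "tensor_scale c t = (\<lambda>B. c * t B)"

definition tensor ::
    "('k::field, 'v::ab_group_add) vs \<Rightarrow> ('k, 'w::ab_group_add) vs \<Rightarrow> ('k, ('k, 'v, 'w) tensor) vs"
    (infixl \<open>\<otimes>\<close> 70) where
  "X \<otimes> Y = \<lparr>scal = tensor_scale,
             carr = module.span tensor_scale {pure_tensor X Y x y | x y. x \<in> carr X \<and> y \<in> carr Y}\<rparr>"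

text \<open>
  The next three maps are the linear maps determined by
  \<open>x \<otimes> y \<mapsto> f x \<otimes> g y\<close>, by \<open>(x \<otimes> y) \<otimes> z \<mapsto> x \<otimes> (y \<otimes> z)\<close> and by
  \<open>(x \<otimes> y) \<otimes> (z \<otimes> w) \<mapsto> (x \<otimes> z) \<otimes> (y \<otimes> w)\<close>; see \<open>tensor_map_pure\<close>, \<open>tensor_assoc_pure\<close> and
  \<open>tensor_interchange_pure\<close>. The last one is where the trivial braiding enters.
\<close>

definition tensor_map ::
    "('k::field, 'v'::ab_group_add) vs \<Rightarrow> ('k, 'w'::ab_group_add) vs \<Rightarrow> ('v \<Rightarrow> 'v') \<Rightarrow> ('w \<Rightarrow> 'w') \<Rightarrow>
     ('k, 'v, 'w) tensor \<Rightarrow> ('k, 'v', 'w') tensor" where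
  "tensor_map X' Y' f g t =
     (\<lambda>B. if bilinear_form X' Y' B then t (\<lambda>x y. B (f x) (g y)) else 0)"

definition tensor_assoc ::
    "('k::field, 'v::ab_group_add) vs \<Rightarrow> ('k, 'w::ab_group_add) vs \<Rightarrow> ('k, 'u::ab_group_add) vs \<Rightarrow>
     ('k, ('k, 'v, 'w) tensor, 'u) tensor \<Rightarrow> ('k, 'v, ('k, 'w, 'u) tensor) tensor" where
  "tensor_assoc X Y Z t =
     (\<lambda>B. if bilinear_form X (Y \<otimes> Z) B
          then t (\<lambda>r z. r (\<lambda>x y. B x (pure_tensor Y Z y z))) else 0)"

definition tensor_interchange ::
    "('k::field, 'v::ab_group_add) vs \<Rightarrow> ('k, 'w::ab_group_add) vs \<Rightarrow>
     ('k, 'u::ab_group_add) vs \<Rightarrow> ('k, 'z::ab_group_add) vs \<Rightarrow>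
     ('k, ('k, 'v, 'w) tensor, ('k, 'u, 'z) tensor) tensor \<Rightarrow>
     ('k, ('k, 'v, 'u) tensor, ('k, 'w, 'z) tensor) tensor" where
  "tensor_interchange X Y Z W t =
     (\<lambda>B. if bilinear_form (X \<otimes> Z) (Y \<otimes> W) B
          then t (\<lambda>r s. r (\<lambda>x y. s (\<lambda>z w. B (pure_tensor X Z x z) (pure_tensor Y W y w)))) else 0)"


section \<open>Hopf monoids in species\<close>

text \<open>
  Finite sets are the finite subsets of a type \<open>'a\<close>. A bijection from \<open>I\<close> to \<open>\<sigma> ` I\<close> is given by a
  function \<open>\<sigma>\<close> that is injective on \<open>I\<close>; \<open>act I \<sigma>\<close> is the map \<open>p[\<sigma>]\<close> and depends only on the values
  of \<open>\<sigma>\<close> on \<open>I\<close>.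
\<close>

locale species =
  fixes p :: "'a set \<Rightarrow> ('k::field, 'v::ab_group_add) vs"
    and act :: "'a set \<Rightarrow> ('a \<Rightarrow> 'a) \<Rightarrow> 'v \<Rightarrow> 'v"
  assumes space: "finite I \<Longrightarrow> vspace (p I)"
    and act_linear: "\<lbrakk>finite I; inj_on \<sigma> I\<rbrakk> \<Longrightarrow> linear_map (p I) (p (\<sigma> ` I)) (act I \<sigma>)"
    and act_cong: "\<lbrakk>finite I; inj_on \<sigma> I; \<forall>i\<in>I. \<sigma> i = \<tau> i; x \<in> carr (p I)\<rbrakk> \<Longrightarrow> act I \<sigma> x = act I \<tau> x"
    and act_id: "\<lbrakk>finite I; x \<in> carr (p I)\<rbrakk> \<Longrightarrow> act I id x = x"
    and act_comp: "\<lbrakk>finite I; inj_on \<sigma> I; inj_on \<tau> (\<sigma> ` I); x \<in> carr (p I)\<rbrakk>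
        \<Longrightarrow> act I (\<tau> \<circ> \<sigma>) x = act (\<sigma> ` I) \<tau> (act I \<sigma> x)"

definition species_morphism ::
    "('a set \<Rightarrow> ('k::field, 'v::ab_group_add) vs) \<Rightarrow> ('a set \<Rightarrow> ('a \<Rightarrow> 'a) \<Rightarrow> 'v \<Rightarrow> 'v) \<Rightarrow>
     ('a set \<Rightarrow> ('k, 'w::ab_group_add) vs) \<Rightarrow> ('a set \<Rightarrow> ('a \<Rightarrow> 'a) \<Rightarrow> 'w \<Rightarrow> 'w) \<Rightarrow>
     ('a set \<Rightarrow> 'v \<Rightarrow> 'w) \<Rightarrow> bool" where
  "species_morphism p act q act' f \<longleftrightarrow>
     (\<forall>I. finite I \<longrightarrow> linear_map (p I) (q I) (f I)) \<and>
     (\<forall>I \<sigma>. finite I \<longrightarrow> inj_on \<sigma> I \<longrightarrow>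
        (\<forall>x\<in>carr (p I). f (\<sigma> ` I) (act I \<sigma> x) = act' I \<sigma> (f I x)))"

text \<open>
  A morphism \<open>p \<cdot> p \<rightarrow> p\<close> out of the Cauchy product amounts to its components
  \<open>\<mu> S T : p[S] \<otimes> p[T] \<rightarrow> p[S \<union> T]\<close> for disjoint \<open>S\<close> and \<open>T\<close>, and a morphism from the unit
  species to \<open>p\<close> to its component \<open>\<iota> : k \<rightarrow> p[{}]\<close>; dually for \<open>\<Delta>\<close> and \<open>\<epsilon>\<close>.
\<close>

locale species_monoid = species p act
  for p :: "'a set \<Rightarrow> ('k::field, 'v::ab_group_add) vs"
    and act :: "'a set \<Rightarrow> ('a \<Rightarrow> 'a) \<Rightarrow> 'v \<Rightarrow> 'v" +
  fixes \<mu> :: "'a set \<Rightarrow> 'a set \<Rightarrow> ('k, 'v, 'v) tensor \<Rightarrow> 'v"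
    and \<iota> :: "'k \<Rightarrow> 'v"
  assumes mult_linear: "\<lbrakk>finite S; finite T; S \<inter> T = {}\<rbrakk>
        \<Longrightarrow> linear_map (p S \<otimes> p T) (p (S \<union> T)) (\<mu> S T)"
    and mult_natural: "\<lbrakk>finite S; finite T; S \<inter> T = {}; inj_on \<sigma> (S \<union> T); t \<in> carr (p S \<otimes> p T)\<rbrakk>
        \<Longrightarrow> act (S \<union> T) \<sigma> (\<mu> S T t)
            = \<mu> (\<sigma> ` S) (\<sigma> ` T) (tensor_map (p (\<sigma> ` S)) (p (\<sigma> ` T)) (act S \<sigma>) (act T \<sigma>) t)"
    and unit_linear: "linear_map base_field (p {}) \<iota>"
    and mult_assoc: "\<lbrakk>finite R; finite S; finite T; R \<inter> S = {}; R \<inter> T = {}; S \<inter> T = {};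
          u \<in> carr ((p R \<otimes> p S) \<otimes> p T)\<rbrakk>
        \<Longrightarrow> \<mu> (R \<union> S) T (tensor_map (p (R \<union> S)) (p T) (\<mu> R S) id u)
            = \<mu> R (S \<union> T) (tensor_map (p R) (p (S \<union> T)) id (\<mu> S T) (tensor_assoc (p R) (p S) (p T) u))"
    and unit_left: "\<lbrakk>finite I; x \<in> carr (p I)\<rbrakk>
        \<Longrightarrow> \<mu> {} I (pure_tensor (p {}) (p I) (\<iota> 1) x) = x"
    and unit_right: "\<lbrakk>finite I; x \<in> carr (p I)\<rbrakk>
        \<Longrightarrow> \<mu> I {} (pure_tensor (p I) (p {}) x (\<iota> 1)) = x"

locale species_comonoid = species p act
  for p :: "'a set \<Rightarrow> ('k::field, 'v::ab_group_add) vs"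
    and act :: "'a set \<Rightarrow> ('a \<Rightarrow> 'a) \<Rightarrow> 'v \<Rightarrow> 'v" +
  fixes \<Delta> :: "'a set \<Rightarrow> 'a set \<Rightarrow> 'v \<Rightarrow> ('k, 'v, 'v) tensor"
    and \<epsilon> :: "'v \<Rightarrow> 'k"
  assumes comult_linear: "\<lbrakk>finite S; finite T; S \<inter> T = {}\<rbrakk>
        \<Longrightarrow> linear_map (p (S \<union> T)) (p S \<otimes> p T) (\<Delta> S T)"
    and comult_natural: "\<lbrakk>finite S; finite T; S \<inter> T = {}; inj_on \<sigma> (S \<union> T); x \<in> carr (p (S \<union> T))\<rbrakk>
        \<Longrightarrow> \<Delta> (\<sigma> ` S) (\<sigma> ` T) (act (S \<union> T) \<sigma> x)
            = tensor_map (p (\<sigma> ` S)) (p (\<sigma> ` T)) (act S \<sigma>) (act T \<sigma>) (\<Delta> S T x)"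
    and counit_linear: "linear_map (p {}) base_field \<epsilon>"
    and comult_coassoc: "\<lbrakk>finite R; finite S; finite T; R \<inter> S = {}; R \<inter> T = {}; S \<inter> T = {};
          x \<in> carr (p (R \<union> S \<union> T))\<rbrakk>
        \<Longrightarrow> tensor_assoc (p R) (p S) (p T)
              (tensor_map (p R \<otimes> p S) (p T) (\<Delta> R S) id (\<Delta> (R \<union> S) T x))
            = tensor_map (p R) (p S \<otimes> p T) id (\<Delta> S T) (\<Delta> R (S \<union> T) x)"
    and counit_left: "\<lbrakk>finite I; x \<in> carr (p I)\<rbrakk>
        \<Longrightarrow> tensor_map base_field (p I) \<epsilon> id (\<Delta> {} I x) = pure_tensor base_field (p I) 1 x"
    and counit_right: "\<lbrakk>finite I; x \<in> carr (p I)\<rbrakk>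
        \<Longrightarrow> tensor_map (p I) base_field id \<epsilon> (\<Delta> I {} x) = pure_tensor (p I) base_field x 1"

text \<open>
  \<open>mult_comult\<close> is compatibility for two decompositions of the same set
  \<open>S \<union> T = S' \<union> T'\<close>, on the four intersections.
\<close>

locale species_bimonoid =
  species_monoid p act \<mu> \<iota> + species_comonoid p act \<Delta> \<epsilon>
  for p :: "'a set \<Rightarrow> ('k::field, 'v::ab_group_add) vs"
    and act :: "'a set \<Rightarrow> ('a \<Rightarrow> 'a) \<Rightarrow> 'v \<Rightarrow> 'v"
    and \<mu> :: "'a set \<Rightarrow> 'a set \<Rightarrow> ('k, 'v, 'v) tensor \<Rightarrow> 'v"
    and \<iota> :: "'k \<Rightarrow> 'v"
    and \<Delta> :: "'a set \<Rightarrow> 'a set \<Rightarrow> 'v \<Rightarrow> ('k, 'v, 'v) tensor"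
    and \<epsilon> :: "'v \<Rightarrow> 'k" +
  assumes mult_comult: "\<lbrakk>finite S; finite T; S \<inter> T = {}; S' \<inter> T' = {}; S \<union> T = S' \<union> T';
          t \<in> carr (p S \<otimes> p T)\<rbrakk>
        \<Longrightarrow> \<Delta> S' T' (\<mu> S T t)
            = tensor_map (p S') (p T') (\<mu> (S \<inter> S') (T \<inter> S')) (\<mu> (S \<inter> T') (T \<inter> T'))
                (tensor_interchange (p (S \<inter> S')) (p (S \<inter> T')) (p (T \<inter> S')) (p (T \<inter> T'))
                  (tensor_map (p (S \<inter> S') \<otimes> p (S \<inter> T')) (p (T \<inter> S') \<otimes> p (T \<inter> T'))
                    (\<Delta> (S \<inter> S') (S \<inter> T')) (\<Delta> (T \<inter> S') (T \<inter> T')) t))"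
    and counit_mult: "\<lbrakk>x \<in> carr (p {}); y \<in> carr (p {})\<rbrakk>
        \<Longrightarrow> \<epsilon> (\<mu> {} {} (pure_tensor (p {}) (p {}) x y)) = \<epsilon> x * \<epsilon> y"
    and comult_unit: "\<Delta> {} {} (\<iota> 1) = pure_tensor (p {}) (p {}) (\<iota> 1) (\<iota> 1)"
    and counit_unit: "\<epsilon> (\<iota> 1) = 1"
begin

definition convolution :: "('a set \<Rightarrow> 'v \<Rightarrow> 'v) \<Rightarrow> ('a set \<Rightarrow> 'v \<Rightarrow> 'v) \<Rightarrow> 'a set \<Rightarrow> 'v \<Rightarrow> 'v" where
  "convolution f g I x =
     (\<Sum>S\<in>Pow I. \<mu> S (I - S) (tensor_map (p S) (p (I - S)) (f S) (g (I - S)) (\<Delta> S (I - S) x)))"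

definition convolution_unit :: "'a set \<Rightarrow> 'v \<Rightarrow> 'v" where
  "convolution_unit I x = (if I = {} then \<iota> (\<epsilon> x) else 0)"

definition antipode :: "('a set \<Rightarrow> 'v \<Rightarrow> 'v) \<Rightarrow> bool" where
  "antipode s \<longleftrightarrow> species_morphism p act p act s \<and>
     (\<forall>I. finite I \<longrightarrow> (\<forall>x\<in>carr (p I).
        convolution s (\<lambda>_. id) I x = convolution_unit I x \<and>
        convolution (\<lambda>_. id) s I x = convolution_unit I x))"

end

locale species_hopf_monoid = species_bimonoid +
  assumes antipode_exists: "\<exists>s. antipode s"


section \<open>Linearization\<close>

definition free_vs :: "'x set \<Rightarrow> ('k::field, 'x \<Rightarrow>\<^sub>0 'k) vs" where
  "free_vs X = \<lparr>scal = (\<lambda>c. Poly_Mapping.map ((*) c)), carr = {f. Poly_Mapping.keys f \<subseteq> X}\<rparr>"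

abbreviation basis :: "'x \<Rightarrow> 'x \<Rightarrow>\<^sub>0 'k::field" where
  "basis x \<equiv> Poly_Mapping.single x 1"

definition lin_ext :: "('k::field \<Rightarrow> 'v::ab_group_add \<Rightarrow> 'v) \<Rightarrow> ('x \<Rightarrow> 'v) \<Rightarrow> ('x \<Rightarrow>\<^sub>0 'k) \<Rightarrow> 'v" where
  "lin_ext s f u = (\<Sum>x\<in>Poly_Mapping.keys u. s (Poly_Mapping.lookup u x) (f x))"

text \<open>
  For finite \<open>X\<close> and \<open>Y\<close>, the linear map \<open>kX \<otimes> kY \<rightarrow> kZ\<close> with \<open>x \<otimes> y \<mapsto> f x y\<close> on basis elements
  (\<open>tensor_ext_basis\<close>, \<open>tensor_ext_linear\<close>). The value of \<open>t\<close> at the bilinear form inside is the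
  coefficient of \<open>x \<otimes> y\<close> in \<open>t\<close>.
\<close>

definition tensor_ext ::
    "'x set \<Rightarrow> 'y set \<Rightarrow> ('x \<Rightarrow> 'y \<Rightarrow> 'z) \<Rightarrow> ('k::field, 'x \<Rightarrow>\<^sub>0 'k, 'y \<Rightarrow>\<^sub>0 'k) tensor \<Rightarrow> 'z \<Rightarrow>\<^sub>0 'k" where
  "tensor_ext X Y f t =
     (\<Sum>x\<in>X. \<Sum>y\<in>Y. Poly_Mapping.single (f x y)
        (t (\<lambda>u v. Poly_Mapping.lookup u x * Poly_Mapping.lookup v y)))"


section \<open>Parking functions\<close>

definition weak_set_composition :: "'a set \<Rightarrow> 'a set list \<Rightarrow> bool" where
  "weak_set_composition I \<Gamma> \<longleftrightarrow>
     \<Union>(set \<Gamma>) = I \<and> (\<forall>i<length \<Gamma>. \<forall>j<length \<Gamma>. i \<noteq> j \<longrightarrow> \<Gamma> ! i \<inter> \<Gamma> ! j = {})"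

definition wsize :: "'a set list \<Rightarrow> nat" where
  "wsize \<Gamma> = (\<Sum>A\<leftarrow>\<Gamma>. card A)"

definition PF :: "'a set \<Rightarrow> 'a set list set" where
  "PF I = {\<Phi>. weak_set_composition I \<Phi> \<and> length \<Phi> = card I \<and>
              (\<forall>k\<in>{1..card I}. k \<le> (\<Sum>i<k. card (\<Phi> ! i)))}"

definition relabel :: "('a \<Rightarrow> 'b) \<Rightarrow> 'a set list \<Rightarrow> 'b set list" where
  "relabel \<sigma> \<Phi> = map (\<lambda>A. \<sigma> ` A) \<Phi>"

definition restrict_comp :: "'a set list \<Rightarrow> 'a set \<Rightarrow> 'a set list" where
  "restrict_comp \<Phi> S = map (\<lambda>A. A \<inter> S) \<Phi>"

definition park :: "'a set list \<Rightarrow> 'a set list" where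
  "park \<Gamma> = foldl (\<lambda>\<Phi> B. if length \<Phi> + 1 \<le> wsize \<Phi> + card B then \<Phi> @ [B] else \<Phi>) [] \<Gamma>"

definition PF_species :: "'a set \<Rightarrow> ('k::field, 'a set list \<Rightarrow>\<^sub>0 'k) vs" where
  "PF_species I = free_vs (PF I)"

definition PF_act ::
    "'a set \<Rightarrow> ('a \<Rightarrow> 'a) \<Rightarrow> ('a set list \<Rightarrow>\<^sub>0 'k::field) \<Rightarrow> ('a set list \<Rightarrow>\<^sub>0 'k)" where
  "PF_act I \<sigma> = lin_ext (scal (PF_species (\<sigma> ` I))) (\<lambda>\<Phi>. basis (relabel \<sigma> \<Phi>))"

definition PF_mult ::
    "'a set \<Rightarrow> 'a set \<Rightarrow> ('k::field, 'a set list \<Rightarrow>\<^sub>0 'k, 'a set list \<Rightarrow>\<^sub>0 'k) tensor \<Rightarrow>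
     ('a set list \<Rightarrow>\<^sub>0 'k)" where
  "PF_mult S T = tensor_ext (PF S) (PF T) (\<lambda>\<Phi> \<Psi>. \<Phi> @ \<Psi>)"

definition PF_comult ::
    "'a set \<Rightarrow> 'a set \<Rightarrow> ('a set list \<Rightarrow>\<^sub>0 'k::field) \<Rightarrow>
     ('k, 'a set list \<Rightarrow>\<^sub>0 'k, 'a set list \<Rightarrow>\<^sub>0 'k) tensor" where
  "PF_comult S T = lin_ext (scal (PF_species S \<otimes> PF_species T))
     (\<lambda>\<Phi>. pure_tensor (PF_species S) (PF_species T)
            (basis (park (restrict_comp \<Phi> S))) (basis (park (restrict_comp \<Phi> T))))"

text \<open>The canonical identification of \<open>k\<close> with \<open>PF[{}] = k{()}\<close> and its inverse.\<close>

definition PF_unit :: "'k::field \<Rightarrow> ('a set list \<Rightarrow>\<^sub>0 'k)" where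
  "PF_unit c = Poly_Mapping.single [] c"

definition PF_counit :: "('a set list \<Rightarrow>\<^sub>0 'k::field) \<Rightarrow> 'k" where
  "PF_counit u = Poly_Mapping.lookup u []"


section \<open>Properties of the encoding\<close>

lemma vector_space_tensor_scale:
  "vector_space (tensor_scale :: 'k::field \<Rightarrow> ('k, 'v, 'w) tensor \<Rightarrow> ('k, 'v, 'w) tensor)"
  by unfold_locales (auto simp: tensor_scale_def fun_eq_iff algebra_simps plus_fun_def)

lemma vspace_tensor: "vspace (X \<otimes> Y)"
proof -
  interpret vector_space tensor_scale by (rule vector_space_tensor_scale)
  show ?thesis
    unfolding vspace_def tensor_def by (auto intro: vector_space_tensor_scale)
qed

lemma pure_tensor_in: "\<lbrakk>x \<in> carr X; y \<in> carr Y\<rbrakk> \<Longrightarrow> pure_tensor X Y x y \<in> carr (X \<otimes> Y)"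
proof -
  interpret vector_space tensor_scale by (rule vector_space_tensor_scale)
  show "x \<in> carr X \<Longrightarrow> y \<in> carr Y \<Longrightarrow> ?thesis"
    unfolding tensor_def by (auto intro!: span_base)
qed

lemma tensor_zero_in: "0 \<in> carr (X \<otimes> Y)"
  and tensor_add_in: "\<lbrakk>t \<in> carr (X \<otimes> Y); u \<in> carr (X \<otimes> Y)\<rbrakk> \<Longrightarrow> t + u \<in> carr (X \<otimes> Y)"
proof -
  interpret vector_space tensor_scale by (rule vector_space_tensor_scale)
  show "0 \<in> carr (X \<otimes> Y)" unfolding tensor_def vs.simps by (rule span_zero)
  show "\<lbrakk>t \<in> carr (X \<otimes> Y); u \<in> carr (X \<otimes> Y)\<rbrakk> \<Longrightarrow> t + u \<in> carr (X \<otimes> Y)"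
    unfolding tensor_def vs.simps by (rule span_add)
qed

lemma tensor_induct [consumes 2, case_names zero pure add]:
  assumes t: "t \<in> carr (X \<otimes> Y)" and X: "vspace X"
    and 0: "P 0"
    and pure: "\<And>x y. \<lbrakk>x \<in> carr X; y \<in> carr Y\<rbrakk> \<Longrightarrow> P (pure_tensor X Y x y)"
    and add: "\<And>t u. \<lbrakk>t \<in> carr (X \<otimes> Y); u \<in> carr (X \<otimes> Y); P t; P u\<rbrakk> \<Longrightarrow> P (t + u)"
  shows "P t"
proof -
  interpret vector_space tensor_scale by (rule vector_space_tensor_scale)
  interpret X: vector_space "scal X" using X by (simp add: vspace_def)
  let ?G = "{pure_tensor X Y x y | x y. x \<in> carr X \<and> y \<in> carr Y}"
  have sub: "X.subspace (carr X)" using X by (simp add: vspace_def)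
  have "t \<in> span ?G" using t by (simp add: tensor_def)
  then have "t \<in> carr (X \<otimes> Y) \<and> P t"
  proof (induction rule: span_induct_alt)
    case base
    show ?case using 0 tensor_zero_in by blast
  next
    case (step c u v)
    then obtain x y where u: "u = pure_tensor X Y x y" "x \<in> carr X" "y \<in> carr Y" by auto
    have cx: "scal X c x \<in> carr X" using u sub by (simp add: X.subspace_scale)
    have "tensor_scale c u = pure_tensor X Y (scal X c x) y"
      using u by (auto simp: tensor_scale_def pure_tensor_def fun_eq_iff bilinear_map_def
          linear_map_def base_field_def)
    moreover have "pure_tensor X Y (scal X c x) y \<in> carr (X \<otimes> Y)"
      using cx u by (intro pure_tensor_in)
    ultimately show ?case using step add[of "tensor_scale c u" v] pure[OF cx u(3)]
      tensor_add_in[of "tensor_scale c u" X Y v] by metis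
  qed
  then show ?thesis by simp
qed

text \<open>Linear functionals separate points.\<close>

lemma functional_separates:
  fixes Z :: "('k::field, 'u::ab_group_add) vs"
  assumes Z: "vspace Z" and "z \<noteq> 0"
  shows "\<exists>\<phi>. linear_map Z base_field \<phi> \<and> \<phi> z = 1"
proof -
  have "vector_space ((*) :: 'k \<Rightarrow> 'k \<Rightarrow> 'k)" by unfold_locales (auto simp: algebra_simps)
  then interpret vector_space_pair "scal Z" "(*) :: 'k \<Rightarrow> 'k \<Rightarrow> 'k"
    using Z by (simp add: vspace_def vector_space_pair_def)
  have "\<exists>g. (\<forall>x\<in>{z}. g x = (\<lambda>_. 1) x) \<and> Vector_Spaces.linear (scal Z) (*) g"
    using linear_independent_extend[of "{z}" "\<lambda>_. 1"] assms(2) by auto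
  then obtain g where g: "Vector_Spaces.linear (scal Z) (*) g" "g z = 1" by auto
  then interpret g: Vector_Spaces.linear "scal Z" "(*)" g by simp
  show ?thesis
    by (rule exI[of _ g]) (auto simp: linear_map_def base_field_def g g.add g.scale)
qed

lemma bilinear_form_comp:
  assumes "bilinear_map X Y Z b" "linear_map Z base_field \<phi>"
  shows "bilinear_form X Y (\<lambda>x y. \<phi> (b x y))"
  using assms unfolding bilinear_map_def linear_map_def by (auto simp: base_field_def)

text \<open>The universal property of the tensor product: uniqueness and existence.\<close>

lemma tensor_map_eqI:
  assumes X: "vspace X" and f: "linear_map (X \<otimes> Y) Z f" and g: "linear_map (X \<otimes> Y) Z g"
    and eq: "\<And>x y. \<lbrakk>x \<in> carr X; y \<in> carr Y\<rbrakk> \<Longrightarrow> f (pure_tensor X Y x y) = g (pure_tensor X Y x y)"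
    and t: "t \<in> carr (X \<otimes> Y)"
  shows "f t = g t"
  using t X
proof (induction rule: tensor_induct)
  case zero
  have "f (0 + 0) = f 0 + f 0" "g (0 + 0) = g 0 + g 0"
    using f g tensor_zero_in unfolding linear_map_def by blast+
  then show ?case by (simp only: add_0_left add_cancel_left_left add_cancel_right_right)
next
  case (pure x y)
  then show ?case by (rule eq)
next
  case (add t u)
  then have "f (t + u) = f t + f u" "g (t + u) = g t + g u"
    using f g unfolding linear_map_def by blast+
  then show ?case using add by (simp only:)
qed

theorem tensor_universal:
  fixes X :: "('k::field, 'v::ab_group_add) vs" and Y :: "('k, 'w::ab_group_add) vs"
    and Z :: "('k, 'u::ab_group_add) vs"
  assumes X: "vspace X" and Y: "vspace Y" and Z: "vspace Z" and b: "bilinear_map X Y Z b"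
  shows "\<exists>f. linear_map (X \<otimes> Y) Z f \<and>
             (\<forall>x\<in>carr X. \<forall>y\<in>carr Y. f (pure_tensor X Y x y) = b x y)"
proof -
  interpret T: vector_space tensor_scale by (rule vector_space_tensor_scale)
  interpret Z: vector_space "scal Z" using Z by (simp add: vspace_def)
  have subZ: "Z.subspace (carr Z)" using Z by (simp add: vspace_def)
  have subT: "T.subspace (carr (X \<otimes> Y))" by (simp add: tensor_def)
  have scalT: "scal (X \<otimes> Y) = tensor_scale" by (simp add: tensor_def)
  define R where "R t z \<longleftrightarrow> z \<in> carr Z \<and> (\<forall>\<phi>. linear_map Z base_field \<phi> \<longrightarrow> \<phi> z = t (\<lambda>x y. \<phi> (b x y)))"
    for t z
  have R0: "R 0 0" unfolding R_def
    by (auto simp: Z.subspace_0[OF subZ] linear_map_def base_field_def)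
       (metis Z.scale_zero_left Z.subspace_0 mult_zero_left subZ)
  have Radd: "R (t + u) (z + w)" if "R t z" "R u w" for t u z w
    using that unfolding R_def by (auto simp: Z.subspace_add[OF subZ] linear_map_def)
  have Rscale: "R (tensor_scale c t) (scal Z c z)" if "R t z" for c t z
    using that unfolding R_def
    by (auto simp: Z.subspace_scale[OF subZ] linear_map_def base_field_def tensor_scale_def)
  have Rpure: "R (pure_tensor X Y x y) (b x y)" if "x \<in> carr X" "y \<in> carr Y" for x y
    using that b bilinear_form_comp[OF b]
    unfolding R_def by (auto simp: pure_tensor_def bilinear_map_def linear_map_def)
  have Runique: "z = w" if "R t z" "R t w" for t z w
  proof (rule ccontr)
    assume "z \<noteq> w"
    then obtain \<phi> where \<phi>: "linear_map Z base_field \<phi>" "\<phi> (z - w) = 1"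
      using functional_separates[OF Z, of "z - w"] by auto
    have "z - w \<in> carr Z" using that subZ by (auto simp: R_def Z.subspace_diff)
    then have "\<phi> (w + (z - w)) = \<phi> w + \<phi> (z - w)"
      using \<phi> that unfolding linear_map_def R_def by blast
    then have "\<phi> z = \<phi> w + 1" using \<phi> by (simp only: add_diff_cancel_left' add_diff_eq)
    moreover have "\<phi> z = \<phi> w" using that \<phi> by (auto simp: R_def)
    ultimately show False by simp
  qed
  have Rex: "\<exists>z. R t z" if "t \<in> carr (X \<otimes> Y)" for t
    using that X by (induction rule: tensor_induct) (use R0 Radd Rpure in blast)+
  define f where "f t = (THE z. R t z)" for t
  have f_eq: "f t = z" if "R t z" for t z
    unfolding f_def using that Runique by blast
  have fR: "R t (f t)" if "t \<in> carr (X \<otimes> Y)" for t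
    using Rex[OF that] f_eq by blast
  have "linear_map (X \<otimes> Y) Z f"
    unfolding linear_map_def scalT
  proof (intro conjI ballI allI)
    show "f t \<in> carr Z" if "t \<in> carr (X \<otimes> Y)" for t
      using fR[OF that] by (simp add: R_def)
    show "f (t + u) = f t + f u" if "t \<in> carr (X \<otimes> Y)" "u \<in> carr (X \<otimes> Y)" for t u
      by (rule f_eq[OF Radd[OF fR[OF that(1)] fR[OF that(2)]]])
    show "f (tensor_scale c t) = scal Z c (f t)" if "t \<in> carr (X \<otimes> Y)" for c t
      by (rule f_eq[OF Rscale[OF fR[OF that]]])
  qed
  moreover have "\<forall>x\<in>carr X. \<forall>y\<in>carr Y. f (pure_tensor X Y x y) = b x y"
    using f_eq Rpure by blast
  ultimately show ?thesis by blast
qed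

lemma tensor_map_pure:
  assumes "linear_map X X' f" "linear_map Y Y' g" "x \<in> carr X" "y \<in> carr Y"
  shows "tensor_map X' Y' f g (pure_tensor X Y x y) = pure_tensor X' Y' (f x) (g y)"
proof -
  have "bilinear_form X Y (\<lambda>x y. B (f x) (g y))" if "bilinear_form X' Y' B" for B
    using that assms unfolding bilinear_map_def linear_map_def by auto
  then show ?thesis by (auto simp: tensor_map_def pure_tensor_def fun_eq_iff)
qed

lemma tensor_map_linear:
  assumes "vspace X" "linear_map X X' f" "linear_map Y Y' g"
  shows "linear_map (X \<otimes> Y) (X' \<otimes> Y') (tensor_map X' Y' f g)"
proof -
  have "tensor_map X' Y' f g t \<in> carr (X' \<otimes> Y')" if "t \<in> carr (X \<otimes> Y)" for t
    using that assms(1)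
  proof (induction rule: tensor_induct)
    case zero
    have "tensor_map X' Y' f g 0 = 0" by (auto simp: tensor_map_def fun_eq_iff)
    then show ?case by (simp only: tensor_zero_in)
  next
    case (pure x y)
    then show ?case using assms
      by (simp add: tensor_map_pure) (auto simp: linear_map_def intro: pure_tensor_in)
  next
    case (add t u)
    have "tensor_map X' Y' f g (t + u) = tensor_map X' Y' f g t + tensor_map X' Y' f g u"
      by (auto simp: tensor_map_def fun_eq_iff)
    with add show ?case by (simp only: tensor_add_in)
  qed
  then show ?thesis
    by (auto simp: linear_map_def tensor_map_def fun_eq_iff tensor_def tensor_scale_def)
qed

lemma vspace_closed:
  assumes "vspace X"
  shows "\<lbrakk>x \<in> carr X; y \<in> carr X\<rbrakk> \<Longrightarrow> x + y \<in> carr X" and "x \<in> carr X \<Longrightarrow> scal X c x \<in> carr X"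
proof -
  interpret vector_space "scal X" using assms by (simp add: vspace_def)
  have "subspace (carr X)" using assms by (simp add: vspace_def)
  then show "\<lbrakk>x \<in> carr X; y \<in> carr X\<rbrakk> \<Longrightarrow> x + y \<in> carr X" "x \<in> carr X \<Longrightarrow> scal X c x \<in> carr X"
    unfolding subspace_def by blast+
qed

lemma pure_tensor_bilinear:
  assumes "vspace X" "vspace Y"
  shows "bilinear_map X Y (X \<otimes> Y) (pure_tensor X Y)"
proof -
  have "scal (X \<otimes> Y) = tensor_scale" by (simp add: tensor_def)
  then show ?thesis
    unfolding bilinear_map_def[of _ _ "X \<otimes> Y"] linear_map_def[of _ "X \<otimes> Y"]
    by (auto simp: pure_tensor_in)
       (auto simp: fun_eq_iff pure_tensor_def tensor_scale_def bilinear_map_def linear_map_def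
          base_field_def)
qed

lemma tensor_eval_linear:
  assumes r: "r \<in> carr (X \<otimes> Y)" and X: "vspace X" and Z: "vspace Z"
    and lin: "\<And>x y. \<lbrakk>x \<in> carr X; y \<in> carr Y\<rbrakk> \<Longrightarrow> linear_map Z base_field (\<lambda>z. F z x y)"
    and bil: "\<And>z. z \<in> carr Z \<Longrightarrow> bilinear_form X Y (F z)"
  shows "linear_map Z base_field (\<lambda>z. r (F z))"
  using r X
proof (induction rule: tensor_induct)
  case zero
  show ?case by (simp add: linear_map_def base_field_def)
next
  case (pure x y)
  then show ?case using lin[of x y] bil vspace_closed[OF Z]
    by (simp add: linear_map_def pure_tensor_def)
next
  case (add t u)
  then show ?case by (auto simp: linear_map_def base_field_def algebra_simps)
qed

lemma eval_linear:
  "linear_map (X \<otimes> Y) base_field (\<lambda>t. t B)"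
  by (auto simp: linear_map_def base_field_def tensor_def tensor_scale_def)

lemma bilinear_comp:
  assumes "bilinear_form X' Y' B" "linear_map X X' f" "linear_map Y Y' g"
  shows "bilinear_form X Y (\<lambda>x y. B (f x) (g y))"
  using assms unfolding bilinear_map_def linear_map_def by auto

lemma linear_map_id: "linear_map X X (\<lambda>x. x)"
  by (simp add: linear_map_def)

lemma pure_tensor_linear:
  assumes "vspace X" "vspace Y"
  shows "x \<in> carr X \<Longrightarrow> linear_map Y (X \<otimes> Y) (pure_tensor X Y x)"
    and "y \<in> carr Y \<Longrightarrow> linear_map X (X \<otimes> Y) (\<lambda>x. pure_tensor X Y x y)"
  using pure_tensor_bilinear[OF assms] by (auto simp: bilinear_map_def)

lemma tensor_assoc_pure:
  assumes "vspace X" "vspace Y" "vspace Z" and xyz: "x \<in> carr X" "y \<in> carr Y" "z \<in> carr Z"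
  shows "tensor_assoc X Y Z (pure_tensor (X \<otimes> Y) Z (pure_tensor X Y x y) z)
       = pure_tensor X (Y \<otimes> Z) x (pure_tensor Y Z y z)"
proof (rule ext)
  fix B
  show "tensor_assoc X Y Z (pure_tensor (X \<otimes> Y) Z (pure_tensor X Y x y) z) B
       = pure_tensor X (Y \<otimes> Z) x (pure_tensor Y Z y z) B"
  proof (cases "bilinear_form X (Y \<otimes> Z) B")
    case True
    have 1: "bilinear_form X Y (\<lambda>x y. B x (pure_tensor Y Z y z))" if "z \<in> carr Z" for z
      using bilinear_comp[OF True linear_map_id] pure_tensor_linear assms that by blast
    have 2: "linear_map Z base_field (\<lambda>z. B x (pure_tensor Y Z y z))"
      if "x \<in> carr X" "y \<in> carr Y" for x y
      using bilinear_comp[OF True linear_map_id pure_tensor_linear(1)[OF assms(2,3)]] that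
      by (auto simp: bilinear_map_def)
    have "bilinear_form (X \<otimes> Y) Z (\<lambda>r z. r (\<lambda>x y. B x (pure_tensor Y Z y z)))"
      unfolding bilinear_map_def[of "X \<otimes> Y"]
      using eval_linear tensor_eval_linear[OF _ assms(1,3) 2 1] by blast
    then show ?thesis using True 1[OF xyz(3)]
      by (simp add: tensor_assoc_def pure_tensor_def[of "X \<otimes> Y"] pure_tensor_def[of X])
  qed (simp add: tensor_assoc_def pure_tensor_def)
qed

lemma tensor_interchange_pure:
  fixes X :: "('k::field, 'v::ab_group_add) vs" and Y :: "('k, 'w::ab_group_add) vs"
    and Z :: "('k, 'u::ab_group_add) vs" and W :: "('k, 'z::ab_group_add) vs"
  assumes "vspace X" "vspace Y" "vspace Z" "vspace W"
    and xyzw: "x \<in> carr X" "y \<in> carr Y" "z \<in> carr Z" "w \<in> carr W"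
  shows "tensor_interchange X Y Z W
           (pure_tensor (X \<otimes> Y) (Z \<otimes> W) (pure_tensor X Y x y) (pure_tensor Z W z w))
       = pure_tensor (X \<otimes> Z) (Y \<otimes> W) (pure_tensor X Z x z) (pure_tensor Y W y w)"
proof (rule ext)
  fix B :: "('k, 'v, 'u) tensor \<Rightarrow> ('k, 'w, 'z) tensor \<Rightarrow> 'k"
  let ?F = "\<lambda>x y z w. B (pure_tensor X Z x z) (pure_tensor Y W y w)"
  show "tensor_interchange X Y Z W
           (pure_tensor (X \<otimes> Y) (Z \<otimes> W) (pure_tensor X Y x y) (pure_tensor Z W z w)) B
       = pure_tensor (X \<otimes> Z) (Y \<otimes> W) (pure_tensor X Z x z) (pure_tensor Y W y w) B"
  proof (cases "bilinear_form (X \<otimes> Z) (Y \<otimes> W) B")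
    case True
    have 1: "bilinear_form Z W (?F x y)" if "x \<in> carr X" "y \<in> carr Y" for x y
      by (rule bilinear_comp[OF True pure_tensor_linear(1)[OF assms(1,3) that(1)]
            pure_tensor_linear(1)[OF assms(2,4) that(2)]])
    have 2: "bilinear_form X Y (\<lambda>x y. ?F x y z w)" if "z \<in> carr Z" "w \<in> carr W" for z w
      by (rule bilinear_comp[OF True pure_tensor_linear(2)[OF assms(1,3) that(1)]
            pure_tensor_linear(2)[OF assms(2,4) that(2)]])
    have 3: "bilinear_form X Y (\<lambda>x y. s (?F x y))" if s: "s \<in> carr (Z \<otimes> W)" for s
      unfolding bilinear_map_def
    proof (intro conjI ballI)
      fix y assume y: "y \<in> carr Y"
      show "linear_map X base_field (\<lambda>x. s (?F x y))"
        by (rule tensor_eval_linear[OF s assms(3,1)]) (use 1 2 y in \<open>auto simp: bilinear_map_def\<close>)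
    next
      fix x assume x: "x \<in> carr X"
      show "linear_map Y base_field (\<lambda>y. s (?F x y))"
        by (rule tensor_eval_linear[OF s assms(3,2)]) (use 1 2 x in \<open>auto simp: bilinear_map_def\<close>)
    qed
    have "bilinear_form (X \<otimes> Y) (Z \<otimes> W) (\<lambda>r s. r (\<lambda>x y. s (?F x y)))"
      unfolding bilinear_map_def[of "X \<otimes> Y"]
    proof (intro conjI ballI eval_linear)
      fix r assume r: "r \<in> carr (X \<otimes> Y)"
      show "linear_map (Z \<otimes> W) base_field (\<lambda>s. r (\<lambda>x y. s (?F x y)))"
        by (rule tensor_eval_linear[OF r assms(1) vspace_tensor]) (use 3 eval_linear in auto)
    qed
    moreover have "bilinear_form X Y (\<lambda>x y. pure_tensor Z W z w (?F x y))"
      by (rule 3) (simp add: pure_tensor_in xyzw)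
    ultimately show ?thesis using True 1[OF xyzw(1,2)]
      by (simp only: tensor_interchange_def if_True pure_tensor_def[of "X \<otimes> Y" "Z \<otimes> W"]
          pure_tensor_def[of "X \<otimes> Z" "Y \<otimes> W"])
         (simp only: pure_tensor_def[of X Y] pure_tensor_def[of Z W] if_True)
  qed (simp add: tensor_interchange_def pure_tensor_def)
qed

lemma lookup_scale:
  "Poly_Mapping.lookup (Poly_Mapping.map ((*) c) f) x = (c :: 'k::field) * Poly_Mapping.lookup f x"
  by (simp add: Poly_Mapping.map.rep_eq when_def)

lemma vspace_free: "vspace (free_vs X :: ('k::field, 'x \<Rightarrow>\<^sub>0 'k) vs)"
proof -
  note lk = lookup_scale
  interpret vector_space "\<lambda>c :: 'k. Poly_Mapping.map ((*) c) :: ('x \<Rightarrow>\<^sub>0 'k) \<Rightarrow> _"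
    by unfold_locales (rule poly_mapping_eqI, simp add: lk lookup_add algebra_simps)+
  have "Poly_Mapping.keys (Poly_Mapping.map ((*) c) f) \<subseteq> Poly_Mapping.keys f" for c and f :: "'x \<Rightarrow>\<^sub>0 'k"
    by (auto simp: in_keys_iff lk)
  then have "subspace {f :: 'x \<Rightarrow>\<^sub>0 'k. Poly_Mapping.keys f \<subseteq> X}"
    unfolding subspace_def using order_trans[OF Poly_Mapping.keys_add]
    by (simp, blast)
  then show ?thesis
    unfolding vspace_def free_vs_def using vector_space_axioms by simp
qed

lemma coordinate_form:
  "bilinear_form (free_vs X) (free_vs Y) (\<lambda>u v. Poly_Mapping.lookup u x * Poly_Mapping.lookup v y)"
  by (auto simp: bilinear_map_def linear_map_def free_vs_def base_field_def lookup_add algebra_simps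
      Poly_Mapping.map.rep_eq when_def)

lemma tensor_ext_basis:
  fixes f :: "'x \<Rightarrow> 'y \<Rightarrow> 'z"
  assumes "finite X" "finite Y" "x \<in> X" "y \<in> Y"
  shows "tensor_ext X Y f (pure_tensor (free_vs X) (free_vs Y) (basis x) (basis y))
       = (basis (f x y) :: 'z \<Rightarrow>\<^sub>0 'k::field)"
proof -
  have "tensor_ext X Y f (pure_tensor (free_vs X) (free_vs Y) (basis x) (basis y)) =
      (\<Sum>a\<in>X. \<Sum>b\<in>Y. if a = x then if b = y then (basis (f x y) :: 'z \<Rightarrow>\<^sub>0 'k) else 0 else 0)"
    unfolding tensor_ext_def
    by (intro sum.cong refl) (auto simp: pure_tensor_def coordinate_form lookup_single when_def)
  also have "\<dots> = (\<Sum>a\<in>X. if a = x then basis (f x y) else 0)"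
    using assms by (intro sum.cong refl) (auto simp: sum.delta)
  also have "\<dots> = basis (f x y)" using assms by (simp add: sum.delta)
  finally show ?thesis .
qed

lemma tensor_ext_linear:
  assumes "finite X" "finite Y" "\<And>x y. \<lbrakk>x \<in> X; y \<in> Y\<rbrakk> \<Longrightarrow> f x y \<in> Z"
  shows "linear_map (free_vs X \<otimes> free_vs Y) (free_vs Z) (tensor_ext X Y f)"
proof -
  have scal: "scal (free_vs X \<otimes> free_vs Y) = tensor_scale" by (simp add: tensor_def)
  have "Poly_Mapping.keys (tensor_ext X Y f t) \<subseteq> Z" for t
    unfolding tensor_ext_def
    by (intro order_trans[OF Poly_Mapping.keys_sum] UN_least) (use assms(3) in auto)
  then show ?thesis
    unfolding linear_map_def scal
    by (auto simp: free_vs_def tensor_ext_def single_add sum.distrib)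
       (auto intro!: poly_mapping_eqI sum.cong simp: tensor_scale_def lookup_sum lookup_single
          lookup_scale when_def sum_distrib_left)
qed

lemma lin_ext_basis:
  fixes X :: "('k::field, 'v::ab_group_add) vs"
  assumes "vspace X"
  shows "lin_ext (scal X) f (basis x) = f x"
proof -
  interpret vector_space "scal X" using assms by (simp add: vspace_def)
  show ?thesis by (simp add: lin_ext_def)
qed

lemma finite_PF: "finite I \<Longrightarrow> finite (PF I)"
  by (rule finite_subset[OF _ finite_lists_length_eq[of "Pow I" "card I"]])
     (auto simp: PF_def weak_set_composition_def)

lemma PF_act_basis: "PF_act I \<sigma> (basis \<Phi>) = basis (relabel \<sigma> \<Phi>)"
  by (simp add: PF_act_def PF_species_def lin_ext_basis vspace_free)

lemma PF_mult_basis: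
  assumes "finite S" "finite T" "\<Phi> \<in> PF S" "\<Psi> \<in> PF T"
  shows "PF_mult S T (pure_tensor (PF_species S) (PF_species T) (basis \<Phi>) (basis \<Psi>)) = basis (\<Phi> @ \<Psi>)"
  using assms by (simp add: PF_mult_def PF_species_def tensor_ext_basis finite_PF)

lemma PF_comult_basis:
  "PF_comult S T (basis \<Phi>) = pure_tensor (PF_species S) (PF_species T)
     (basis (park (restrict_comp \<Phi> S))) (basis (park (restrict_comp \<Phi> T)))"
  by (simp add: PF_comult_def lin_ext_basis vspace_tensor)

end

(* Parking discards only empty blocks, and only at saturated moments, when the number of blocks kept
   equals their total size. Restricting a parking function to a subset and parking gives again a
   saturated list, so a discarded block is also discarded after any further restriction, and
   concatenation with a parking function restarts the process. This gives coassociativity and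
   compatibility on basis elements. The antipode is Takeuchi's formula: on a parking function Phi
   it is the alternating sum, over the compositions (S_1, ..., S_k) of I into nonempty blocks, of
   park (Phi cap S_1) | ... | park (Phi cap S_k). In its convolution with the identity, the terms
   in which the identity gets the empty set cancel the others, which are the same terms with the
   last (or first) block split off and the sign reversed. *)
theory Submission
  imports Defs
begin

section \<open>Linear maps on free spaces and their tensor products\<close>

text \<open>The axioms speak of arbitrary tensors, and the structure maps are functions on ambient
  types, for which landing in the right span has to be proved. Most axioms are therefore brought
  into the form of two linear maps between the same spaces that agree on basis tensors, where they
  become identities between lists of blocks. The saturation named in the overview is a count. In a
  parking function on n elements the first j blocks hold at least j elements, so the later ones hold
  at most n - j, one per remaining position. Restriction only shrinks the later blocks, so this
  bound survives it for every j, and that is what forces the length of the parked list up to its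
  size. Each component of the coproduct sends a basis element to a single basis tensor, and a
  product of basis elements is a basis element. So the terms of Takeuchi's formula are signed basis
  elements, and the cancellation is a bijection between index sets.\<close>

lemma linear_mapD:
  assumes "linear_map X Y f" "x \<in> carr X"
  shows linear_map_in: "f x \<in> carr Y"
    and linear_map_add: "x' \<in> carr X \<Longrightarrow> f (x + x') = f x + f x'"
    and linear_map_scale: "f (scal X c x) = scal Y c (f x)"
  using assms by (auto simp: linear_map_def)

lemma linear_map_comp:
  "\<lbrakk>linear_map X Y g; linear_map Y Z f\<rbrakk> \<Longrightarrow> linear_map X Z (\<lambda>x. f (g x))"
  by (simp add: linear_map_def)

lemma vspace_zero: "vspace X \<Longrightarrow> 0 \<in> carr X"
proof -
  assume X: "vspace X"
  then interpret vector_space "scal X" by (simp add: vspace_def)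
  show ?thesis using X by (simp add: vspace_def subspace_def)
qed

lemma vspace_sum: "\<lbrakk>vspace X; \<And>i. i \<in> A \<Longrightarrow> x i \<in> carr X\<rbrakk> \<Longrightarrow> sum x A \<in> carr X"
  by (induction A rule: infinite_finite_induct) (auto simp: vspace_zero vspace_closed(1))

lemma linear_map_zero:
  assumes "vspace X" "linear_map X Y f"
  shows "f 0 = 0"
proof -
  have "f (0 + 0) = f 0 + f 0"
    using assms by (intro linear_map_add) (auto intro: vspace_zero)
  then show ?thesis by simp
qed

lemma linear_map_sum:
  assumes "vspace X" "linear_map X Y f" "\<And>i. i \<in> A \<Longrightarrow> x i \<in> carr X"
  shows "f (\<Sum>i\<in>A. x i) = (\<Sum>i\<in>A. f (x i))"
  using assms(3)
proof (induction A rule: infinite_finite_induct)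
  case (insert a A)
  then have "f (x a + sum x A) = f (x a) + f (sum x A)"
    by (intro linear_map_add[OF assms(2)] vspace_sum assms(1)) auto
  with insert show ?case by simp
qed (simp_all add: linear_map_zero[OF assms(1,2)])

lemma linear_map_sum_fun:
  assumes "vspace Y" "\<And>i. i \<in> A \<Longrightarrow> linear_map X Y (f i)"
  shows "linear_map X Y (\<lambda>x. \<Sum>i\<in>A. f i x)"
proof -
  interpret vector_space "scal Y" using assms by (simp add: vspace_def)
  show ?thesis
    using assms(2) unfolding linear_map_def
    by (auto intro!: vspace_sum assms(1) simp: sum.distrib scale_sum_right)
qed

lemma linear_map_zero_fun: "vspace Y \<Longrightarrow> linear_map X Y (\<lambda>_. 0)"
  using linear_map_sum_fun[of Y "{}" X] by simp

lemma linear_map_id_fun: "linear_map X X id"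
  by (simp add: linear_map_def)

lemma vspace_base_field: "vspace base_field"
proof -
  interpret vector_space "(*) :: 'k \<Rightarrow> 'k \<Rightarrow> 'k::field"
    by unfold_locales (auto simp: algebra_simps)
  show ?thesis by (simp add: vspace_def base_field_def vector_space_axioms)
qed

text \<open>Additivity carries membership in the target from pure tensors to the whole span, so
  membership is asked for pure tensors only. This suits maps given by a formula on functionals,
  whose additivity and homogeneity hold pointwise.\<close>

lemma linear_map_tensorI:
  assumes "vspace X" "vspace Z"
    and add: "\<And>t u. \<lbrakk>t \<in> carr (X \<otimes> Y); u \<in> carr (X \<otimes> Y)\<rbrakk> \<Longrightarrow> f (t + u) = f t + f u"
    and scale: "\<And>c t. t \<in> carr (X \<otimes> Y) \<Longrightarrow> f (scal (X \<otimes> Y) c t) = scal Z c (f t)"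
    and pure: "\<And>x y. \<lbrakk>x \<in> carr X; y \<in> carr Y\<rbrakk> \<Longrightarrow> f (pure_tensor X Y x y) \<in> carr Z"
  shows "linear_map (X \<otimes> Y) Z f"
proof -
  have f0: "f 0 = 0"
    using add[OF tensor_zero_in tensor_zero_in] by simp
  have "f t \<in> carr Z" if "t \<in> carr (X \<otimes> Y)" for t
    using that assms(1)
  proof (induction rule: tensor_induct)
    case zero
    show ?case unfolding f0 by (rule vspace_zero[OF assms(2)])
  next
    case (pure x y)
    then show ?case by (rule assms(5))
  next
    case (add t u)
    then show ?case unfolding assms(3)[OF add(1,2)] by (intro vspace_closed(1) assms(2))
  qed
  then show ?thesis using add scale by (simp add: linear_map_def)
qed

text \<open>A pure tensor of \<open>(X \<otimes> Y) \<otimes> Z\<close> still has an arbitrary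
  tensor \<open>r\<close> in its first slot. With \<open>z\<close> fixed, the map in
  \<open>r\<close> is itself tested on pure tensors, where \<open>tensor_assoc_pure\<close> gives
  the value.\<close>

lemma tensor_assoc_linear:
  assumes "vspace X" "vspace Y" "vspace Z"
  shows "linear_map ((X \<otimes> Y) \<otimes> Z) (X \<otimes> (Y \<otimes> Z)) (tensor_assoc X Y Z)"
proof -
  let ?f = "tensor_assoc X Y Z"
  have add: "?f (t + u) = ?f t + ?f u" for t u
    by (auto simp: tensor_assoc_def fun_eq_iff)
  have scale: "?f (scal ((X \<otimes> Y) \<otimes> Z) c t) = scal (X \<otimes> (Y \<otimes> Z)) c (?f t)" for c t
    by (auto simp: tensor_assoc_def fun_eq_iff tensor_def tensor_scale_def)
  have "?f (pure_tensor (X \<otimes> Y) Z r z) \<in> carr (X \<otimes> (Y \<otimes> Z))"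
    if r: "r \<in> carr (X \<otimes> Y)" and z: "z \<in> carr Z" for r z
  proof -
    note lin = pure_tensor_linear(2)[OF vspace_tensor assms(3) z]
    have "linear_map (X \<otimes> Y) (X \<otimes> (Y \<otimes> Z)) (\<lambda>r. ?f (pure_tensor (X \<otimes> Y) Z r z))"
      by (rule linear_map_tensorI[OF assms(1) vspace_tensor])
        (auto simp only: linear_map_add[OF lin] linear_map_scale[OF lin] add scale
          tensor_assoc_pure assms z intro!: pure_tensor_in)
    then show ?thesis using r by (rule linear_map_in)
  qed
  then show ?thesis
    by (intro linear_map_tensorI vspace_tensor add scale)
qed

text \<open>Both slots hold arbitrary tensors, so the reduction to pure tensors is nested: step
  \<open>1\<close> varies the second slot with a pure tensor in the first, and then the first slot
  varies.\<close>

lemma tensor_interchange_linear: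
  assumes "vspace X" "vspace Y" "vspace Z" "vspace W"
  shows "linear_map ((X \<otimes> Y) \<otimes> (Z \<otimes> W)) ((X \<otimes> Z) \<otimes> (Y \<otimes> W)) (tensor_interchange X Y Z W)"
proof -
  let ?f = "tensor_interchange X Y Z W" and ?T = "(X \<otimes> Z) \<otimes> (Y \<otimes> W)"
  let ?p = "pure_tensor (X \<otimes> Y) (Z \<otimes> W)"
  have add: "?f (t + u) = ?f t + ?f u" for t u
    by (auto simp: tensor_interchange_def fun_eq_iff)
  have scale: "?f (scal ((X \<otimes> Y) \<otimes> (Z \<otimes> W)) c t) = scal ?T c (?f t)" for c t
    by (auto simp: tensor_interchange_def fun_eq_iff tensor_def tensor_scale_def)
  have 1: "?f (?p (pure_tensor X Y x y) s) \<in> carr ?T"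
    if xy: "x \<in> carr X" "y \<in> carr Y" and s: "s \<in> carr (Z \<otimes> W)" for x y s
  proof -
    note lin = pure_tensor_linear(1)[OF vspace_tensor vspace_tensor pure_tensor_in[OF xy]]
    have "linear_map (Z \<otimes> W) ?T (\<lambda>s. ?f (?p (pure_tensor X Y x y) s))"
      by (rule linear_map_tensorI[OF assms(3) vspace_tensor])
        (auto simp only: linear_map_add[OF lin] linear_map_scale[OF lin] add scale
          tensor_interchange_pure assms xy intro!: pure_tensor_in)
    then show ?thesis using s by (rule linear_map_in)
  qed
  have "?f (?p r s) \<in> carr ?T" if r: "r \<in> carr (X \<otimes> Y)" and s: "s \<in> carr (Z \<otimes> W)" for r s
  proof -
    note lin = pure_tensor_linear(2)[OF vspace_tensor vspace_tensor s]
    have "linear_map (X \<otimes> Y) ?T (\<lambda>r. ?f (?p r s))"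
      by (rule linear_map_tensorI[OF assms(1) vspace_tensor])
        (simp_all only: linear_map_add[OF lin] linear_map_scale[OF lin] add scale 1 s)
    then show ?thesis using r by (rule linear_map_in)
  qed
  then show ?thesis
    by (intro linear_map_tensorI vspace_tensor add scale)
qed

section \<open>Linear maps out of free spaces\<close>

lemma scal_free: "scal (free_vs X) c (basis x) = Poly_Mapping.single x c"
  by (rule poly_mapping_eqI) (simp add: free_vs_def lookup_scale lookup_single when_def)

lemma basis_in_free: "x \<in> X \<Longrightarrow> basis x \<in> carr (free_vs X)"
  by (simp add: free_vs_def)

lemma linear_map_free_eqI:
  assumes f: "linear_map (free_vs X) Z f" and g: "linear_map (free_vs X) Z g"
    and eq: "\<And>x. x \<in> X \<Longrightarrow> f (basis x) = g (basis x)"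
    and u: "u \<in> carr (free_vs X)"
  shows "f u = g u"
proof -
  let ?t = "\<lambda>x. scal (free_vs X) (Poly_Mapping.lookup u x) (basis x)"
  have keys: "Poly_Mapping.keys u \<subseteq> X" using u by (simp add: free_vs_def)
  have u_eq: "u = (\<Sum>x\<in>Poly_Mapping.keys u. ?t x)"
    by (rule poly_mapping_eqI)
       (auto simp: scal_free lookup_sum lookup_single when_def sum.delta in_keys_iff)
  have t: "?t x \<in> carr (free_vs X)" if "x \<in> Poly_Mapping.keys u" for x
    using keys that by (intro vspace_closed(2) vspace_free basis_in_free) auto
  have "f u = (\<Sum>x\<in>Poly_Mapping.keys u. f (?t x))"
    by (rule trans[OF arg_cong[OF u_eq, of f]], rule linear_map_sum[OF vspace_free f t])
  also have "\<dots> = (\<Sum>x\<in>Poly_Mapping.keys u. g (?t x))"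
  proof (rule sum.cong[OF refl])
    fix x assume "x \<in> Poly_Mapping.keys u"
    then have "x \<in> X" using keys by auto
    then show "f (?t x) = g (?t x)"
      by (simp only: linear_map_scale[OF f basis_in_free] linear_map_scale[OF g basis_in_free] eq)
  qed
  also have "\<dots> = g u"
    by (rule sym, rule trans[OF arg_cong[OF u_eq, of g]], rule linear_map_sum[OF vspace_free g t])
  finally show ?thesis .
qed

lemma lin_ext_linear:
  fixes Z :: "('k::field, 'v::ab_group_add) vs" and f :: "'x \<Rightarrow> 'v"
  assumes Z: "vspace Z" and f: "\<And>x. x \<in> X \<Longrightarrow> f x \<in> carr Z"
  shows "linear_map (free_vs X) Z (lin_ext (scal Z) f)"
proof -
  interpret vector_space "scal Z" using Z by (simp add: vspace_def)
  \<comment> \<open>Supports may shrink under addition through cancellation, so the sums are moved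
    to a common finite set; the additional terms have coefficient 0.\<close>
  have supp: "lin_ext (scal Z) f u = (\<Sum>x\<in>A. scal Z (Poly_Mapping.lookup u x) (f x))"
    if "finite A" "Poly_Mapping.keys u \<subseteq> A" for u A
    unfolding lin_ext_def using that
    by (intro sum.mono_neutral_left) (auto simp: in_keys_iff)
  have add: "lin_ext (scal Z) f (u + v) = lin_ext (scal Z) f u + lin_ext (scal Z) f v" for u v
    using supp[of "Poly_Mapping.keys u \<union> Poly_Mapping.keys v"] Poly_Mapping.keys_add[of u v]
    by (simp add: lookup_add scale_left_distrib sum.distrib)
  have "Poly_Mapping.keys (Poly_Mapping.map ((*) c) u) \<subseteq> Poly_Mapping.keys u"
    for c :: 'k and u :: "'x \<Rightarrow>\<^sub>0 'k"
    by (auto simp: in_keys_iff lookup_scale)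
  then have scale: "lin_ext (scal Z) f (Poly_Mapping.map ((*) c) u) = scal Z c (lin_ext (scal Z) f u)"
    for c u
    using supp[of "Poly_Mapping.keys u"] by (simp add: lookup_scale scale_sum_right)
  have "lin_ext (scal Z) f u \<in> carr Z" if "Poly_Mapping.keys u \<subseteq> X" for u
    unfolding lin_ext_def using that by (intro vspace_sum vspace_closed(2) Z f) auto
  then show ?thesis
    using add scale by (simp add: linear_map_def free_vs_def)
qed

lemma tensor_free_eqI:
  fixes f g :: "('k::field, 'x \<Rightarrow>\<^sub>0 'k, 'w::ab_group_add) tensor \<Rightarrow> 'v::ab_group_add"
  assumes f: "linear_map (free_vs X \<otimes> Y) Z f" and g: "linear_map (free_vs X \<otimes> Y) Z g"
    and Y: "vspace Y"
    and eq: "\<And>x y. \<lbrakk>x \<in> X; y \<in> carr Y\<rbrakk> \<Longrightarrow>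
      f (pure_tensor (free_vs X) Y (basis x) y) = g (pure_tensor (free_vs X) Y (basis x) y)"
    and t: "t \<in> carr (free_vs X \<otimes> Y)"
  shows "f t = g t"
proof (rule tensor_map_eqI[OF vspace_free f g _ t])
  fix u :: "'x \<Rightarrow>\<^sub>0 'k" and y
  assume u: "u \<in> carr (free_vs X)" and y: "y \<in> carr Y"
  note p = pure_tensor_linear(2)[OF vspace_free Y y]
  show "f (pure_tensor (free_vs X) Y u y) = g (pure_tensor (free_vs X) Y u y)"
    by (rule linear_map_free_eqI[OF linear_map_comp[OF p f] linear_map_comp[OF p g] eq u])
       (use y in auto)
qed

lemma tensor_free_free_eqI:
  fixes f g :: "('k::field, 'x \<Rightarrow>\<^sub>0 'k, 'y \<Rightarrow>\<^sub>0 'k) tensor \<Rightarrow> 'v::ab_group_add"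
  assumes f: "linear_map (free_vs X \<otimes> free_vs Y) Z f" and g: "linear_map (free_vs X \<otimes> free_vs Y) Z g"
    and eq: "\<And>x y. \<lbrakk>x \<in> X; y \<in> Y\<rbrakk> \<Longrightarrow>
      f (pure_tensor (free_vs X) (free_vs Y) (basis x) (basis y))
      = g (pure_tensor (free_vs X) (free_vs Y) (basis x) (basis y))"
    and t: "t \<in> carr (free_vs X \<otimes> free_vs Y)"
  shows "f t = g t"
proof (rule tensor_free_eqI[OF f g vspace_free _ t])
  fix x and v :: "'y \<Rightarrow>\<^sub>0 'k"
  assume x: "x \<in> X" and v: "v \<in> carr (free_vs Y)"
  note p = pure_tensor_linear(1)[OF vspace_free vspace_free basis_in_free[OF x]]
  show "f (pure_tensor (free_vs X) (free_vs Y) (basis x) v)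
      = g (pure_tensor (free_vs X) (free_vs Y) (basis x) v)"
    by (rule linear_map_free_eqI[OF linear_map_comp[OF p f] linear_map_comp[OF p g] eq v])
       (use x in auto)
qed

text \<open>Serves associativity of the product, whose source is a triple tensor product;
  coassociativity starts from a free space instead.\<close>

lemma tensor_free3_eqI:
  fixes f g :: "('k::field, ('k, 'x \<Rightarrow>\<^sub>0 'k, 'y \<Rightarrow>\<^sub>0 'k) tensor, 'w \<Rightarrow>\<^sub>0 'k) tensor \<Rightarrow> 'v::ab_group_add"
  assumes f: "linear_map ((free_vs X \<otimes> free_vs Y) \<otimes> free_vs W) Z f"
    and g: "linear_map ((free_vs X \<otimes> free_vs Y) \<otimes> free_vs W) Z g"
    and eq: "\<And>x y w. \<lbrakk>x \<in> X; y \<in> Y; w \<in> W\<rbrakk> \<Longrightarrow>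
      f (pure_tensor (free_vs X \<otimes> free_vs Y) (free_vs W)
          (pure_tensor (free_vs X) (free_vs Y) (basis x) (basis y)) (basis w))
      = g (pure_tensor (free_vs X \<otimes> free_vs Y) (free_vs W)
          (pure_tensor (free_vs X) (free_vs Y) (basis x) (basis y)) (basis w))"
    and t: "t \<in> carr ((free_vs X \<otimes> free_vs Y) \<otimes> free_vs W)"
  shows "f t = g t"
proof (rule tensor_map_eqI[OF vspace_tensor f g _ t])
  let ?p = "pure_tensor (free_vs X \<otimes> free_vs Y) (free_vs W)"
  fix r :: "('k, 'x \<Rightarrow>\<^sub>0 'k, 'y \<Rightarrow>\<^sub>0 'k) tensor" and w :: "'w \<Rightarrow>\<^sub>0 'k"
  assume r: "r \<in> carr (free_vs X \<otimes> free_vs Y)" and w: "w \<in> carr (free_vs W)"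
  note p1 = pure_tensor_linear(1)[OF vspace_tensor vspace_free r]
  have "f (?p r (basis a)) = g (?p r (basis a))" if a: "a \<in> W" for a
  proof -
    note p2 = pure_tensor_linear(2)[OF vspace_tensor vspace_free basis_in_free[OF a]]
    show ?thesis
      by (rule tensor_free_free_eqI[OF linear_map_comp[OF p2 f] linear_map_comp[OF p2 g] eq r])
         (use a in auto)
  qed
  then show "f (?p r w) = g (?p r w)"
    by (rule linear_map_free_eqI[OF linear_map_comp[OF p1 f] linear_map_comp[OF p1 g] _ w])
qed


section \<open>Parking\<close>

text \<open>The parking inequalities without the demand that length and total size agree, so that
  every intermediate result of \<open>park\<close> satisfies them.\<close>

definition parked :: "'a set list \<Rightarrow> bool" where
  "parked \<Phi> \<longleftrightarrow> (\<forall>k\<le>length \<Phi>. k \<le> wsize (take k \<Phi>))"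

text \<open>Comparing only earlier with later blocks loses nothing, disjointness being symmetric,
  and it unfolds along \<open>Cons\<close> and append in list inductions.\<close>

abbreviation disjoint_blocks :: "'a set list \<Rightarrow> bool" where
  "disjoint_blocks \<equiv> sorted_wrt (\<lambda>A B. A \<inter> B = {})"

abbreviation finite_blocks :: "'a set list \<Rightarrow> bool" where
  "finite_blocks \<Gamma> \<equiv> \<forall>B\<in>set \<Gamma>. finite B"

lemma wsize_simps [simp]:
  "wsize [] = 0" "wsize (B # \<Gamma>) = card B + wsize \<Gamma>" "wsize (\<Gamma> @ \<Delta>) = wsize \<Gamma> + wsize \<Delta>"
  by (simp_all add: wsize_def)

lemma restrict_comp_simps [simp]:
  "restrict_comp [] S = []" "restrict_comp (B # \<Gamma>) S = (B \<inter> S) # restrict_comp \<Gamma> S"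
  "restrict_comp (\<Gamma> @ \<Delta>) S = restrict_comp \<Gamma> S @ restrict_comp \<Delta> S"
  "length (restrict_comp \<Gamma> S) = length \<Gamma>"
  by (simp_all add: restrict_comp_def)

lemma relabel_simps [simp]:
  "relabel \<sigma> [] = []" "relabel \<sigma> (B # \<Gamma>) = \<sigma> ` B # relabel \<sigma> \<Gamma>"
  "relabel \<sigma> (\<Gamma> @ \<Delta>) = relabel \<sigma> \<Gamma> @ relabel \<sigma> \<Delta>" "length (relabel \<sigma> \<Gamma>) = length \<Gamma>"
  by (simp_all add: relabel_def)

lemma park_Nil [simp]: "park [] = []"
  by (simp add: park_def)

lemma park_snoc:
  "park (\<Gamma> @ [B]) = (if length (park \<Gamma>) + 1 \<le> wsize (park \<Gamma>) + card B then park \<Gamma> @ [B] else park \<Gamma>)"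
  by (simp add: park_def)

lemma weak_set_composition_iff:
  "weak_set_composition I \<Gamma> \<longleftrightarrow> \<Union>(set \<Gamma>) = I \<and> disjoint_blocks \<Gamma>"
proof -
  have "(\<forall>i<length \<Gamma>. \<forall>j<length \<Gamma>. i \<noteq> j \<longrightarrow> \<Gamma> ! i \<inter> \<Gamma> ! j = {})"
    if "disjoint_blocks \<Gamma>"
  proof (intro allI impI)
    fix i j assume "i < length \<Gamma>" "j < length \<Gamma>" "i \<noteq> j"
    then consider "i < j" | "j < i" by linarith
    then show "\<Gamma> ! i \<inter> \<Gamma> ! j = {}"
      by cases (use that \<open>i < length \<Gamma>\<close> \<open>j < length \<Gamma>\<close> in \<open>auto simp: sorted_wrt_iff_nth_less\<close>)
  qed
  moreover have "disjoint_blocks \<Gamma>"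
    if "\<forall>i<length \<Gamma>. \<forall>j<length \<Gamma>. i \<noteq> j \<longrightarrow> \<Gamma> ! i \<inter> \<Gamma> ! j = {}"
    unfolding sorted_wrt_iff_nth_less using that by (metis nat_neq_iff order.strict_trans)
  ultimately show ?thesis
    unfolding weak_set_composition_def by blast
qed

lemma wsize_disjoint_blocks:
  "\<lbrakk>disjoint_blocks \<Gamma>; finite (\<Union>(set \<Gamma>))\<rbrakk> \<Longrightarrow> wsize \<Gamma> = card (\<Union>(set \<Gamma>))"
proof (induction \<Gamma>)
  case (Cons B \<Gamma>)
  then have "B \<inter> \<Union>(set \<Gamma>) = {}" by auto
  with Cons show ?case by (simp add: card_Un_disjoint)
qed simp

section \<open>Parked lists and the steps of parking\<close>

lemma parked_Nil [simp]: "parked []"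
  by (simp add: parked_def)

text \<open>Appending creates one new prefix, the whole list, and its inequality is the test by
  which \<open>park\<close> keeps a block. Hence outputs of \<open>park\<close> are parked, and
  parked lists are its fixed points.\<close>

lemma parked_snoc: "parked (\<Phi> @ [B]) \<longleftrightarrow> parked \<Phi> \<and> length \<Phi> + 1 \<le> wsize \<Phi> + card B"
proof -
  have "(\<forall>k\<le>length (\<Phi> @ [B]). k \<le> wsize (take k (\<Phi> @ [B]))) \<longleftrightarrow>
    (\<forall>k\<le>length \<Phi>. k \<le> wsize (take k (\<Phi> @ [B]))) \<and> length \<Phi> + 1 \<le> wsize (\<Phi> @ [B])"
    by (auto simp: le_Suc_eq all_conj_distrib imp_disjL)
  then show ?thesis by (simp add: parked_def)
qed

lemma parked_length_le: "parked \<Phi> \<Longrightarrow> length \<Phi> \<le> wsize \<Phi>"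
  unfolding parked_def by (drule spec[of _ "length \<Phi>"]) simp

lemma PF_iff:
  "\<Phi> \<in> PF I \<longleftrightarrow> weak_set_composition I \<Phi> \<and> length \<Phi> = card I \<and> parked \<Phi>"
proof -
  have "wsize (take k \<Phi>) = (\<Sum>i<k. card (\<Phi> ! i))" if "k \<le> length \<Phi>" for k
    using that by (simp add: wsize_def sum_list_sum_nth atLeast0LessThan)
  \<comment> \<open>The instance k = 0 is free, so the range may start at the empty prefix.\<close>
  moreover have "(\<forall>k\<in>{1..n}. k \<le> f k) \<longleftrightarrow> (\<forall>k\<le>n. k \<le> f k)" for n and f :: "nat \<Rightarrow> nat"
    by (metis atLeastAtMost_iff le_0_eq less_one linorder_not_le zero_le)
  ultimately show ?thesis unfolding PF_def parked_def by auto
qed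

lemma PF_D:
  assumes "\<Phi> \<in> PF I"
  shows "\<Union>(set \<Phi>) = I" "disjoint_blocks \<Phi>" "length \<Phi> = card I" "parked \<Phi>"
  using assms by (auto simp: PF_iff weak_set_composition_iff)

lemma PF_wsize: "\<lbrakk>finite I; \<Phi> \<in> PF I\<rbrakk> \<Longrightarrow> wsize \<Phi> = length \<Phi>"
  using wsize_disjoint_blocks[of \<Phi>] PF_D[of \<Phi> I] by simp

lemma PF_finite_blocks: "\<lbrakk>finite I; \<Phi> \<in> PF I\<rbrakk> \<Longrightarrow> finite_blocks \<Phi>"
  using PF_D(1) by (metis Union_upper finite_subset)

lemma PF_empty: "PF {} = {[]}"
  by (auto simp: PF_iff weak_set_composition_iff)

lemma parked_park: "parked (park \<Gamma>)"
  by (induction \<Gamma> rule: rev_induct) (auto simp: park_snoc parked_snoc)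

lemma park_parked: "parked \<Phi> \<Longrightarrow> park \<Phi> = \<Phi>"
  by (induction \<Phi> rule: rev_induct) (auto simp: park_snoc parked_snoc)

text \<open>A failed test means that size plus \<open>card B\<close> is at most the length, while a
  parked list has length at most its size. Together they leave only equality and
  \<open>card B = 0\<close>.\<close>

lemma park_discard:
  assumes "\<not> length (park \<Gamma>) + 1 \<le> wsize (park \<Gamma>) + card B"
  shows "card B = 0" "length (park \<Gamma>) = wsize (park \<Gamma>)"
  using assms parked_length_le[OF parked_park, of \<Gamma>] by auto

lemma wsize_park: "wsize (park \<Gamma>) = wsize \<Gamma>"
proof (induction \<Gamma> rule: rev_induct)
  case (snoc B \<Gamma>)
  then show ?case using park_discard(1)[of \<Gamma> B] by (auto simp: park_snoc)
qed simp

lemma set_park_subset: "set (park \<Gamma>) \<subseteq> set \<Gamma>"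
  by (induction \<Gamma> rule: rev_induct) (auto simp: park_snoc)

text \<open>Finiteness matters because an infinite set has \<open>card\<close> 0 and could be
  discarded together with its elements.\<close>

lemma Union_park: "finite_blocks \<Gamma> \<Longrightarrow> \<Union>(set (park \<Gamma>)) = \<Union>(set \<Gamma>)"
proof (induction \<Gamma> rule: rev_induct)
  case (snoc B \<Gamma>)
  then show ?case using park_discard(1)[of \<Gamma> B] by (cases "B = {}") (auto simp: park_snoc)
qed simp

lemma disjoint_blocks_park: "disjoint_blocks \<Gamma> \<Longrightarrow> disjoint_blocks (park \<Gamma>)"
  by (induction \<Gamma> rule: rev_induct)
     (use set_park_subset in \<open>fastforce simp: park_snoc sorted_wrt_append\<close>)+

text \<open>At saturation the length and size counters have advanced by the same amount, which
  cancels in every later test.\<close>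

lemma park_append:
  assumes "length (park \<Gamma>) = wsize \<Gamma>"
  shows "park (\<Gamma> @ \<Delta>) = park \<Gamma> @ park \<Delta>"
proof (induction \<Delta> rule: rev_induct)
  case (snoc B \<Delta>)
  have "park ((\<Gamma> @ \<Delta>) @ [B]) = park \<Gamma> @ park (\<Delta> @ [B])"
    unfolding park_snoc snoc using assms by (simp add: wsize_park)
  then show ?case by simp
qed simp

text \<open>
  In fact \<open>length (park \<Gamma>)\<close> is the minimum of \<open>wsize (take j \<Gamma>) + (length \<Gamma> - j)\<close> over \<open>j\<close>: the
  minimum is attained at the last time when \<open>length \<Phi> = wsize \<Phi>\<close>.
\<close>

lemma length_park_ge:
  "\<forall>j\<le>length \<Gamma>. n \<le> wsize (take j \<Gamma>) + (length \<Gamma> - j) \<Longrightarrow> n \<le> length (park \<Gamma>)"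
proof (induction \<Gamma> arbitrary: n rule: rev_induct)
  case Nil
  then show ?case by simp
next
  case (snoc B \<Gamma>)
  have "n - 1 \<le> wsize (take j \<Gamma>) + (length \<Gamma> - j)" if "j \<le> length \<Gamma>" for j
    using snoc.prems[rule_format, of j] that by auto
  then have 1: "n - 1 \<le> length (park \<Gamma>)" by (intro snoc.IH) auto
  have "n \<le> wsize \<Gamma> + card B" using snoc.prems[rule_format, of "length \<Gamma> + 1"] by simp
  with 1 show ?case by (auto simp: park_snoc wsize_park)
qed

section \<open>Restriction followed by parking\<close>

lemma wsize_restrict_le: "finite_blocks \<Gamma> \<Longrightarrow> wsize (restrict_comp \<Gamma> S) \<le> wsize \<Gamma>"
  by (induction \<Gamma>) (auto intro!: add_mono card_mono)

text \<open>A parked list is never longer than its size. For the converse,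
  \<open>length_park_ge\<close> asks for a bound at each cut j: after restriction the tail
  contributes at most \<open>wsize (drop j \<Phi>)\<close>, and this is at most
  \<open>length \<Phi> - j\<close>, since the first j blocks hold at least j of the
  \<open>length \<Phi>\<close> elements counted.\<close>

lemma length_park_restrict:
  assumes "parked \<Phi>" "length \<Phi> = wsize \<Phi>" "finite_blocks \<Phi>"
  shows "length (park (restrict_comp \<Phi> S)) = wsize (restrict_comp \<Phi> S)"
proof (rule antisym)
  show "length (park (restrict_comp \<Phi> S)) \<le> wsize (restrict_comp \<Phi> S)"
    using parked_length_le[OF parked_park] by (metis wsize_park)
  have "wsize (restrict_comp \<Phi> S) \<le> wsize (take j (restrict_comp \<Phi> S)) + (length \<Phi> - j)"
    if j: "j \<le> length \<Phi>" for j
  proof -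
    have "wsize (restrict_comp \<Phi> S)
        = wsize (restrict_comp (take j \<Phi>) S) + wsize (restrict_comp (drop j \<Phi>) S)"
      by (metis append_take_drop_id restrict_comp_simps(3) wsize_simps(3))
    also have "restrict_comp (take j \<Phi>) S = take j (restrict_comp \<Phi> S)"
      by (simp add: restrict_comp_def take_map)
    finally have 1: "wsize (restrict_comp \<Phi> S)
        = wsize (take j (restrict_comp \<Phi> S)) + wsize (restrict_comp (drop j \<Phi>) S)" .
    have 2: "wsize (restrict_comp (drop j \<Phi>) S) \<le> wsize (drop j \<Phi>)"
      using assms(3) by (intro wsize_restrict_le) (auto dest: in_set_dropD)
    have "j \<le> wsize (take j \<Phi>)" using assms(1) j by (simp add: parked_def)
    moreover have "wsize \<Phi> = wsize (take j \<Phi>) + wsize (drop j \<Phi>)"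
      by (metis append_take_drop_id wsize_simps(3))
    ultimately show ?thesis using 1 2 assms(2) by linarith
  qed
  then show "wsize (restrict_comp \<Phi> S) \<le> length (park (restrict_comp \<Phi> S))"
    by (intro length_park_ge) auto
qed

text \<open>When a block is discarded, the blocks kept so far form a parked list with length equal
  to size, so \<open>length_park_restrict\<close> applies to them: parking after restriction is
  saturated at that moment too, and the empty block is dropped again.\<close>

lemma park_restrict_park:
  "finite_blocks \<Gamma> \<Longrightarrow> park (restrict_comp (park \<Gamma>) R) = park (restrict_comp \<Gamma> R)"
proof (induction \<Gamma> rule: rev_induct)
  case Nil
  then show ?case by simp
next
  case (snoc B \<Gamma>)
  then have IH: "park (restrict_comp (park \<Gamma>) R) = park (restrict_comp \<Gamma> R)" by simp
  show ?case
  proof (cases "length (park \<Gamma>) + 1 \<le> wsize (park \<Gamma>) + card B")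
    case True
    then show ?thesis by (simp add: park_snoc IH)
  next
    case False
    note d = park_discard[OF False]
    have fin: "finite_blocks (park \<Gamma>)" using snoc.prems set_park_subset[of \<Gamma>] by auto
    have "B = {}" using d(1) snoc.prems by auto
    moreover have "length (park (restrict_comp \<Gamma> R)) = wsize (park (restrict_comp \<Gamma> R))"
      using length_park_restrict[OF parked_park d(2) fin, of R] by (simp add: IH[symmetric] wsize_park)
    ultimately show ?thesis using False IH by (simp add: park_snoc)
  qed
qed

lemma restrict_restrict: "R \<subseteq> S \<Longrightarrow> restrict_comp (restrict_comp \<Gamma> S) R = restrict_comp \<Gamma> R"
  by (auto simp: restrict_comp_def)

lemma finite_blocks_restrict: "finite_blocks \<Gamma> \<Longrightarrow> finite_blocks (restrict_comp \<Gamma> S)"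
  by (auto simp: restrict_comp_def)

text \<open>The intermediate parking is invisible, so both iterated coproducts of \<Phi> consist of
  the same three parks of direct restrictions.\<close>

lemma park_coassoc:
  assumes "finite I" "\<Phi> \<in> PF I" "R \<subseteq> S"
  shows "park (restrict_comp (park (restrict_comp \<Phi> S)) R) = park (restrict_comp \<Phi> R)"
  using park_restrict_park[OF finite_blocks_restrict[OF PF_finite_blocks[OF assms(1,2)]]]
  by (simp add: restrict_restrict assms(3))

lemma park_restrict_in_PF:
  assumes "finite I" "\<Phi> \<in> PF I" "S \<subseteq> I"
  shows "park (restrict_comp \<Phi> S) \<in> PF S"
proof -
  let ?\<Gamma> = "restrict_comp \<Phi> S"
  have un: "\<Union>(set ?\<Gamma>) = S" using PF_D(1)[OF assms(2)] assms(3) by (auto simp: restrict_comp_def)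
  have dis: "disjoint_blocks ?\<Gamma>"
    using PF_D(2)[OF assms(2)] by (auto simp: restrict_comp_def sorted_wrt_map elim: sorted_wrt_mono_rel[rotated])
  have fin: "finite_blocks \<Phi>" using PF_finite_blocks assms by blast
  have "length (park ?\<Gamma>) = wsize ?\<Gamma>"
    by (rule length_park_restrict[OF PF_D(4)[OF assms(2)] PF_wsize[OF assms(1,2), symmetric] fin])
  also have "\<dots> = card S"
    using wsize_disjoint_blocks[OF dis] un finite_subset[OF assms(3,1)] by simp
  finally show ?thesis
    using parked_park disjoint_blocks_park[OF dis] Union_park[OF finite_blocks_restrict[OF fin]] un
    by (simp add: PF_iff weak_set_composition_iff)
qed

text \<open>Compatibility of product and coproduct on basis elements. Here \<Psi> may be any list,
  since only the first factor has to reach saturation.\<close>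

lemma park_restrict_append:
  assumes "finite I" "\<Phi> \<in> PF I"
  shows "park (restrict_comp (\<Phi> @ \<Psi>) S) = park (restrict_comp \<Phi> S) @ park (restrict_comp \<Psi> S)"
  using length_park_restrict[OF PF_D(4)[OF assms(2)] PF_wsize[OF assms, symmetric]
    PF_finite_blocks[OF assms]]
  by (simp add: park_append)

lemma park_restrict_superset:
  assumes "\<Phi> \<in> PF I" "I \<subseteq> S"
  shows "park (restrict_comp \<Phi> S) = \<Phi>"
proof -
  have "restrict_comp \<Phi> S = \<Phi>"
    using PF_D(1)[OF assms(1)] assms(2) by (auto simp: restrict_comp_def intro!: map_idI)
  then show ?thesis using park_parked PF_D(4)[OF assms(1)] by simp
qed

lemma restrict_Int: "\<Union>(set \<Gamma>) \<subseteq> I \<Longrightarrow> restrict_comp \<Gamma> (I \<inter> S) = restrict_comp \<Gamma> S"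
  by (auto simp: restrict_comp_def)

text \<open>Every output of \<open>park\<close> is parked, so it is enough to see that the
  concatenation is a fixed point of \<open>park\<close>; the prefixes need no inspection.\<close>

lemma parked_append:
  assumes "parked \<Phi>" "wsize \<Phi> = length \<Phi>" "parked \<Psi>"
  shows "parked (\<Phi> @ \<Psi>)"
proof -
  have "park (\<Phi> @ \<Psi>) = \<Phi> @ \<Psi>"
    using assms by (simp add: park_append park_parked)
  then show ?thesis using parked_park by metis
qed

lemma append_in_PF:
  assumes "finite S" "finite T" "S \<inter> T = {}" "\<Phi> \<in> PF S" "\<Psi> \<in> PF T"
  shows "\<Phi> @ \<Psi> \<in> PF (S \<union> T)"
proof -
  have "disjoint_blocks (\<Phi> @ \<Psi>)"
    using PF_D(1,2)[OF assms(4)] PF_D(1,2)[OF assms(5)] assms(3) by (auto simp: sorted_wrt_append)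
  moreover have "parked (\<Phi> @ \<Psi>)"
    by (intro parked_append PF_wsize[OF assms(1)] PF_D(4)[OF assms(4)] PF_D(4)[OF assms(5)] assms)
  ultimately show ?thesis
    using PF_D(1,3)[OF assms(4)] PF_D(1,3)[OF assms(5)] assms(1-3)
    by (auto simp: PF_iff weak_set_composition_iff card_Un_disjoint)
qed

section \<open>Relabelling\<close>

lemma wsize_relabel: "inj_on \<sigma> (\<Union>(set \<Gamma>)) \<Longrightarrow> wsize (relabel \<sigma> \<Gamma>) = wsize \<Gamma>"
  by (induction \<Gamma>) (auto simp: inj_on_Un card_image)

text \<open>Injectivity preserves the size of every block, so each parking test has the same outcome
  before and after.\<close>

lemma park_relabel: "inj_on \<sigma> (\<Union>(set \<Gamma>)) \<Longrightarrow> park (relabel \<sigma> \<Gamma>) = relabel \<sigma> (park \<Gamma>)"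
proof (induction \<Gamma> rule: rev_induct)
  case (snoc B \<Gamma>)
  then have inj: "inj_on \<sigma> B" "inj_on \<sigma> (\<Union>(set \<Gamma>))" by (auto simp: inj_on_Un)
  have "wsize (relabel \<sigma> (park \<Gamma>)) = wsize \<Gamma>"
    by (metis inj(2) snoc.IH wsize_park wsize_relabel)
  then show ?case using inj snoc.IH by (simp add: park_snoc card_image wsize_park)
qed simp

lemma restrict_relabel:
  assumes "inj_on \<sigma> I" "\<Union>(set \<Gamma>) \<subseteq> I" "S \<subseteq> I"
  shows "restrict_comp (relabel \<sigma> \<Gamma>) (\<sigma> ` S) = relabel \<sigma> (restrict_comp \<Gamma> S)"
  using assms(2) by (induction \<Gamma>) (auto simp: inj_on_image_Int[OF assms(1) _ assms(3)])

lemma park_restrict_relabel: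
  assumes "inj_on \<sigma> I" "\<Phi> \<in> PF I" "S \<subseteq> I"
  shows "park (restrict_comp (relabel \<sigma> \<Phi>) (\<sigma> ` S)) = relabel \<sigma> (park (restrict_comp \<Phi> S))"
proof -
  have "\<Union>(set (restrict_comp \<Phi> S)) \<subseteq> I" using assms(3) by (auto simp: restrict_comp_def)
  then have "inj_on \<sigma> (\<Union>(set (restrict_comp \<Phi> S)))" using assms(1) inj_on_subset by blast
  then show ?thesis
    using restrict_relabel[OF assms(1) _ assms(3)] PF_D(1)[OF assms(2)] by (simp add: park_relabel)
qed

lemma disjoint_blocks_relabel:
  "inj_on \<sigma> (\<Union>(set \<Gamma>)) \<Longrightarrow> disjoint_blocks \<Gamma> \<Longrightarrow> disjoint_blocks (relabel \<sigma> \<Gamma>)"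
  by (induction \<Gamma>) (auto simp: relabel_def inj_on_def)

lemma relabel_in_PF:
  assumes "inj_on \<sigma> I" "\<Phi> \<in> PF I"
  shows "relabel \<sigma> \<Phi> \<in> PF (\<sigma> ` I)"
proof -
  note D = PF_D[OF assms(2)]
  \<comment> \<open>Parkedness is again read off from being a fixed point of
    \<open>park\<close>.\<close>
  have "park (relabel \<sigma> \<Phi>) = relabel \<sigma> \<Phi>"
    using assms D by (simp add: park_relabel park_parked)
  then have "parked (relabel \<sigma> \<Phi>)" using parked_park by metis
  moreover have "\<Union>(set (relabel \<sigma> \<Phi>)) = \<sigma> ` I" using D(1) by (auto simp: relabel_def)
  ultimately show ?thesis
    using disjoint_blocks_relabel[of \<sigma> \<Phi>] assms(1) D by (simp add: PF_iff weak_set_composition_iff card_image)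
qed

lemma relabel_cong: "\<lbrakk>\<forall>i\<in>\<Union>(set \<Gamma>). \<sigma> i = \<tau> i\<rbrakk> \<Longrightarrow> relabel \<sigma> \<Gamma> = relabel \<tau> \<Gamma>"
  by (auto simp: relabel_def image_def)

lemma relabel_id: "relabel id \<Gamma> = \<Gamma>"
  by (simp add: relabel_def)

lemma relabel_comp: "relabel (\<tau> \<circ> \<sigma>) \<Gamma> = relabel \<tau> (relabel \<sigma> \<Gamma>)"
  by (simp add: relabel_def image_comp)


section \<open>The bimonoid of parking functions\<close>

lemma vspace_PF [simp]: "vspace (PF_species I)"
  by (simp add: PF_species_def vspace_free)

lemma basis_in_PF_species: "\<Phi> \<in> PF I \<Longrightarrow> basis \<Phi> \<in> carr (PF_species I)"
  by (simp add: PF_species_def basis_in_free)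

lemma scal_PF: "scal (PF_species I) c (basis \<Phi>) = Poly_Mapping.single \<Phi> c"
  by (simp add: PF_species_def scal_free)

lemmas PF_eqI = linear_map_free_eqI[where X = "PF I" for I, folded PF_species_def]
  and PF_tensor_eqI =
    tensor_free_free_eqI[where X = "PF I" and Y = "PF J" for I J, folded PF_species_def]
  and PF_tensor3_eqI =
    tensor_free3_eqI[where X = "PF I" and Y = "PF J" and W = "PF K" for I J K, folded PF_species_def]
  and PF_lin_ext_linear = lin_ext_linear[where X = "PF I" for I, folded PF_species_def]

lemma PF_act_linear:
  "inj_on \<sigma> I \<Longrightarrow> linear_map (PF_species I) (PF_species (\<sigma> ` I)) (PF_act I \<sigma>)"
  unfolding PF_act_def by (intro PF_lin_ext_linear vspace_PF basis_in_PF_species relabel_in_PF)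

lemma PF_mult_linear:
  "\<lbrakk>finite S; finite T; S \<inter> T = {}\<rbrakk> \<Longrightarrow>
     linear_map (PF_species S \<otimes> PF_species T) (PF_species (S \<union> T)) (PF_mult S T)"
  unfolding PF_mult_def PF_species_def
  by (intro tensor_ext_linear finite_PF) (auto intro: append_in_PF)

lemma PF_comult_linear:
  "\<lbrakk>finite S; finite T\<rbrakk> \<Longrightarrow>
     linear_map (PF_species (S \<union> T)) (PF_species S \<otimes> PF_species T) (PF_comult S T)"
  unfolding PF_comult_def
  by (intro PF_lin_ext_linear vspace_tensor pure_tensor_in basis_in_PF_species
      park_restrict_in_PF[of "S \<union> T"]) auto

lemma PF_unit_linear: "linear_map base_field (PF_species {}) PF_unit"
  by (auto simp: linear_map_def base_field_def PF_species_def free_vs_def PF_unit_def PF_empty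
      single_add intro!: poly_mapping_eqI simp: lookup_single lookup_scale when_def)

lemma PF_counit_linear: "linear_map (PF_species {}) base_field PF_counit"
  by (auto simp: linear_map_def base_field_def PF_species_def free_vs_def PF_counit_def
      lookup_add lookup_scale)

lemma PF_unit_1: "PF_unit 1 = basis []"
  by (simp add: PF_unit_def)

lemma PF_species_species: "species (PF_species :: 'a set \<Rightarrow> ('k::field, 'a set list \<Rightarrow>\<^sub>0 'k) vs) PF_act"
proof
  fix I :: "'a set" and \<sigma> \<tau> :: "'a \<Rightarrow> 'a" and x :: "'a set list \<Rightarrow>\<^sub>0 'k"
  show "vspace (PF_species I)" by simp
  show "linear_map (PF_species I) (PF_species (\<sigma> ` I)) (PF_act I \<sigma>)" if "inj_on \<sigma> I"
    using that by (rule PF_act_linear)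
  assume x: "x \<in> carr (PF_species I)"
  show "PF_act I id x = x"
  proof (rule PF_eqI[OF _ linear_map_id _ x])
    show "linear_map (PF_species I) (PF_species I) (PF_act I id)"
      using PF_act_linear[of id I] by (simp add: id_def)
  qed (simp only: PF_act_basis relabel_id)
  assume inj: "inj_on \<sigma> I"
  show "PF_act I \<sigma> x = PF_act I \<tau> x" if eq: "\<forall>i\<in>I. \<sigma> i = \<tau> i"
  proof -
    \<comment> \<open>The two actions need the same target space before they can be compared on
      basis elements.\<close>
    have "\<sigma> ` I = \<tau> ` I" "inj_on \<tau> I" using eq inj by (auto simp: inj_on_def)
    then show ?thesis
      using PF_D(1) eq
      by (intro PF_eqI[OF PF_act_linear[OF inj] _ _ x])
         (auto simp: PF_act_linear PF_act_basis intro!: arg_cong[of _ _ basis] relabel_cong)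
  qed
  show "PF_act I (\<tau> \<circ> \<sigma>) x = PF_act (\<sigma> ` I) \<tau> (PF_act I \<sigma> x)" if "inj_on \<tau> (\<sigma> ` I)"
  proof (rule PF_eqI[OF _ linear_map_comp[OF PF_act_linear[OF inj] PF_act_linear[OF that]] _ x])
    show "linear_map (PF_species I) (PF_species (\<tau> ` \<sigma> ` I)) (PF_act I (\<tau> \<circ> \<sigma>))"
      using PF_act_linear[OF comp_inj_on[OF inj that]] by (simp only: image_comp)
  qed (simp only: PF_act_basis relabel_comp)
qed

text \<open>On basis tensors the axioms become facts about lists: relabelling distributes over
  append, append is associative, the empty list is neutral. The remaining work is to exhibit both
  sides as linear maps with equal source and target.\<close>

lemma PF_monoid:
  "species_monoid (PF_species :: 'a set \<Rightarrow> ('k::field, 'a set list \<Rightarrow>\<^sub>0 'k) vs) PF_act PF_mult PF_unit"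
proof (rule species_monoid.intro[OF PF_species_species], unfold_locales)
  fix R S T I :: "'a set" and \<sigma> :: "'a \<Rightarrow> 'a" and x :: "'a set list \<Rightarrow>\<^sub>0 'k"
    and t :: "('k, 'a set list \<Rightarrow>\<^sub>0 'k, 'a set list \<Rightarrow>\<^sub>0 'k) tensor"
    and u :: "('k, ('k, 'a set list \<Rightarrow>\<^sub>0 'k, 'a set list \<Rightarrow>\<^sub>0 'k) tensor, 'a set list \<Rightarrow>\<^sub>0 'k) tensor"
  let ?p = "PF_species :: 'a set \<Rightarrow> ('k, 'a set list \<Rightarrow>\<^sub>0 'k) vs"
  show "linear_map base_field (?p {}) PF_unit" by (rule PF_unit_linear)
  show "linear_map (?p S \<otimes> ?p T) (?p (S \<union> T)) (PF_mult S T)"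
    if "finite S" "finite T" "S \<inter> T = {}"
    using that by (rule PF_mult_linear)
  show "PF_act (S \<union> T) \<sigma> (PF_mult S T t) =
      PF_mult (\<sigma> ` S) (\<sigma> ` T) (tensor_map (?p (\<sigma> ` S)) (?p (\<sigma> ` T)) (PF_act S \<sigma>) (PF_act T \<sigma>) t)"
    if fin: "finite S" "finite T" and dis: "S \<inter> T = {}" and inj: "inj_on \<sigma> (S \<union> T)"
      and t: "t \<in> carr (?p S \<otimes> ?p T)"
  proof -
    have injs: "inj_on \<sigma> S" "inj_on \<sigma> T" and dis': "\<sigma> ` S \<inter> \<sigma> ` T = {}"
      using inj dis by (auto simp: inj_on_Un)
    note lS = PF_act_linear[OF injs(1)] and lT = PF_act_linear[OF injs(2)]
    note f = linear_map_comp[OF PF_mult_linear[OF fin dis] PF_act_linear[OF inj], unfolded image_Un]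
    note g = linear_map_comp[OF tensor_map_linear[OF vspace_PF lS lT]
        PF_mult_linear[OF finite_imageI[OF fin(1)] finite_imageI[OF fin(2)] dis']]
    show ?thesis
      by (rule PF_tensor_eqI[OF f g _ t])
         (simp add: tensor_map_pure[OF lS lT] basis_in_PF_species PF_mult_basis fin PF_act_basis
            relabel_in_PF injs)
  qed
  show "PF_mult (R \<union> S) T (tensor_map (?p (R \<union> S)) (?p T) (PF_mult R S) id u) =
      PF_mult R (S \<union> T) (tensor_map (?p R) (?p (S \<union> T)) id (PF_mult S T)
        (tensor_assoc (?p R) (?p S) (?p T) u))"
    if fin: "finite R" "finite S" "finite T" and dis: "R \<inter> S = {}" "R \<inter> T = {}" "S \<inter> T = {}"
      and u: "u \<in> carr ((?p R \<otimes> ?p S) \<otimes> ?p T)"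
  proof -
    have fin': "finite (R \<union> S)" "finite (S \<union> T)"
      and dis': "(R \<union> S) \<inter> T = {}" "R \<inter> (S \<union> T) = {}" using fin dis by auto
    note RS = PF_mult_linear[OF fin(1,2) dis(1)] and ST = PF_mult_linear[OF fin(2,3) dis(3)]
    note f = linear_map_comp[OF tensor_map_linear[OF vspace_tensor RS linear_map_id_fun]
        PF_mult_linear[OF fin'(1) fin(3) dis'(1)], unfolded Un_assoc]
    note g = linear_map_comp[OF tensor_assoc_linear[OF vspace_PF vspace_PF vspace_PF]
        linear_map_comp[OF tensor_map_linear[OF vspace_PF linear_map_id_fun ST]
          PF_mult_linear[OF fin(1) fin'(2) dis'(2)]]]
    show ?thesis
      by (rule PF_tensor3_eqI[OF f g _ u])
         (simp add: tensor_map_pure[OF RS linear_map_id_fun] tensor_map_pure[OF linear_map_id_fun ST]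
            tensor_assoc_pure pure_tensor_in basis_in_PF_species PF_mult_basis fin fin'
            append_in_PF dis)
  qed
  have nil: "basis [] \<in> carr (?p {})" by (intro basis_in_PF_species) (simp add: PF_empty)
  assume fin: "finite I" and x: "x \<in> carr (?p I)"
  note l = PF_mult_linear[of "{}" I, simplified, OF fin] and r = PF_mult_linear[of I "{}", simplified, OF fin]
  show "PF_mult {} I (pure_tensor (?p {}) (?p I) (PF_unit 1) x) = x"
    unfolding PF_unit_1
    by (rule PF_eqI[OF linear_map_comp[OF pure_tensor_linear(1)[OF vspace_PF vspace_PF nil] l]
          linear_map_id _ x]) (simp add: PF_mult_basis fin PF_empty)
  show "PF_mult I {} (pure_tensor (?p I) (?p {}) x (PF_unit 1)) = x"
    unfolding PF_unit_1
    by (rule PF_eqI[OF linear_map_comp[OF pure_tensor_linear(2)[OF vspace_PF vspace_PF nil] r]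
          linear_map_id _ x]) (simp add: PF_mult_basis fin PF_empty)
qed

text \<open>The kept list stays empty, so the test reads 1 \<le> 0 at every step.\<close>

lemma park_restrict_empty: "park (restrict_comp \<Phi> {}) = []"
  by (induction \<Phi> rule: rev_induct) (auto simp: park_snoc)

lemma PF_counit_nil: "PF_counit (basis []) = 1"
  by (simp add: PF_counit_def)

text \<open>Behind naturality stands \<open>park_restrict_relabel\<close>, behind coassociativity
  \<open>park_coassoc\<close>. For the counit, restriction to all of I changes nothing, while
  restriction to the empty set parks to the empty list.\<close>

lemma PF_comonoid:
  "species_comonoid (PF_species :: 'a set \<Rightarrow> ('k::field, 'a set list \<Rightarrow>\<^sub>0 'k) vs) PF_act PF_comult PF_counit"
proof (rule species_comonoid.intro[OF PF_species_species], unfold_locales)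
  fix R S T I :: "'a set" and \<sigma> :: "'a \<Rightarrow> 'a" and x :: "'a set list \<Rightarrow>\<^sub>0 'k"
  let ?p = "PF_species :: 'a set \<Rightarrow> ('k, 'a set list \<Rightarrow>\<^sub>0 'k) vs"
  show "linear_map (?p {}) base_field PF_counit" by (rule PF_counit_linear)
  show "linear_map (?p (S \<union> T)) (?p S \<otimes> ?p T) (PF_comult S T)"
    if "finite S" "finite T"
    using that by (rule PF_comult_linear)
  show "PF_comult (\<sigma> ` S) (\<sigma> ` T) (PF_act (S \<union> T) \<sigma> x) =
      tensor_map (?p (\<sigma> ` S)) (?p (\<sigma> ` T)) (PF_act S \<sigma>) (PF_act T \<sigma>) (PF_comult S T x)"
    if fin: "finite S" "finite T" and dis: "S \<inter> T = {}" and inj: "inj_on \<sigma> (S \<union> T)"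
      and x: "x \<in> carr (?p (S \<union> T))"
  proof -
    have injs: "inj_on \<sigma> S" "inj_on \<sigma> T" using inj by (auto simp: inj_on_Un)
    note lS = PF_act_linear[OF injs(1)] and lT = PF_act_linear[OF injs(2)]
    note f = linear_map_comp[OF PF_act_linear[OF inj, unfolded image_Un]
        PF_comult_linear[OF finite_imageI[OF fin(1)] finite_imageI[OF fin(2)]]]
    note g = linear_map_comp[OF PF_comult_linear[OF fin] tensor_map_linear[OF vspace_PF lS lT]]
    show ?thesis
      by (rule PF_eqI[OF f g _ x])
         (simp add: PF_act_basis PF_comult_basis tensor_map_pure[OF lS lT] basis_in_PF_species
            park_restrict_in_PF[of "S \<union> T"] fin park_restrict_relabel[OF inj])
  qed
  show "tensor_assoc (?p R) (?p S) (?p T)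
        (tensor_map (?p R \<otimes> ?p S) (?p T) (PF_comult R S) id (PF_comult (R \<union> S) T x)) =
      tensor_map (?p R) (?p S \<otimes> ?p T) id (PF_comult S T) (PF_comult R (S \<union> T) x)"
    if fin: "finite R" "finite S" "finite T" and x: "x \<in> carr (?p (R \<union> S \<union> T))"
  proof -
    have fin': "finite (R \<union> S)" "finite (S \<union> T)" "finite (R \<union> S \<union> T)" using fin by auto
    note RS = PF_comult_linear[OF fin(1,2)] and ST = PF_comult_linear[OF fin(2,3)]
    note f = linear_map_comp[OF PF_comult_linear[OF fin'(1) fin(3)]
        linear_map_comp[OF tensor_map_linear[OF vspace_PF RS linear_map_id_fun]
          tensor_assoc_linear[OF vspace_PF vspace_PF vspace_PF]]]
    note g = linear_map_comp[OF PF_comult_linear[OF fin(1) fin'(2), folded Un_assoc]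
        tensor_map_linear[OF vspace_PF linear_map_id_fun ST]]
    have PF: "park (restrict_comp \<Phi> A) \<in> PF A" if "\<Phi> \<in> PF (R \<union> S \<union> T)" "A \<subseteq> R \<union> S \<union> T" for \<Phi> A
      using park_restrict_in_PF[OF fin'(3) that] .
    show ?thesis
      by (rule PF_eqI[OF f g _ x])
         (simp add: PF_comult_basis tensor_map_pure[OF RS linear_map_id_fun]
            tensor_map_pure[OF linear_map_id_fun ST] tensor_assoc_pure basis_in_PF_species PF
            park_coassoc[OF fin'(3)] le_supI1)
  qed
  assume fin: "finite I" and x: "x \<in> carr (?p I)"
  note l = PF_comult_linear[of "{}" I, simplified, OF fin] and r = PF_comult_linear[of I "{}", simplified, OF fin]
  have one: "1 \<in> carr (base_field :: ('k, 'k) vs)" by (simp add: base_field_def)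
  show "tensor_map base_field (?p I) PF_counit id (PF_comult {} I x) = pure_tensor base_field (?p I) 1 x"
    by (rule PF_eqI[OF linear_map_comp[OF l tensor_map_linear[OF vspace_PF PF_counit_linear linear_map_id_fun]]
          pure_tensor_linear(1)[OF vspace_base_field vspace_PF one] _ x])
       (simp add: PF_comult_basis park_restrict_empty park_restrict_superset
          tensor_map_pure[OF PF_counit_linear linear_map_id_fun] basis_in_PF_species PF_empty PF_counit_nil)
  show "tensor_map (?p I) base_field id PF_counit (PF_comult I {} x) = pure_tensor (?p I) base_field x 1"
    by (rule PF_eqI[OF linear_map_comp[OF r tensor_map_linear[OF vspace_PF linear_map_id_fun PF_counit_linear]]
          pure_tensor_linear(2)[OF vspace_PF vspace_base_field one] _ x])
       (simp add: PF_comult_basis park_restrict_empty park_restrict_superset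
          tensor_map_pure[OF linear_map_id_fun PF_counit_linear] basis_in_PF_species PF_empty PF_counit_nil)
qed

lemma PF_bimonoid:
  "species_bimonoid (PF_species :: 'a set \<Rightarrow> ('k::field, 'a set list \<Rightarrow>\<^sub>0 'k) vs)
     PF_act PF_mult PF_unit PF_comult PF_counit"
proof (rule species_bimonoid.intro[OF PF_monoid PF_comonoid], unfold_locales)
  fix S T S' T' :: "'a set" and x y :: "'a set list \<Rightarrow>\<^sub>0 'k"
    and t :: "('k, 'a set list \<Rightarrow>\<^sub>0 'k, 'a set list \<Rightarrow>\<^sub>0 'k) tensor"
  let ?p = "PF_species :: 'a set \<Rightarrow> ('k, 'a set list \<Rightarrow>\<^sub>0 'k) vs"
  show "PF_comult S' T' (PF_mult S T t) =
      tensor_map (?p S') (?p T') (PF_mult (S \<inter> S') (T \<inter> S')) (PF_mult (S \<inter> T') (T \<inter> T'))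
        (tensor_interchange (?p (S \<inter> S')) (?p (S \<inter> T')) (?p (T \<inter> S')) (?p (T \<inter> T'))
          (tensor_map (?p (S \<inter> S') \<otimes> ?p (S \<inter> T')) (?p (T \<inter> S') \<otimes> ?p (T \<inter> T'))
            (PF_comult (S \<inter> S') (S \<inter> T')) (PF_comult (T \<inter> S') (T \<inter> T')) t))"
    if fin: "finite S" "finite T" and dis: "S \<inter> T = {}" "S' \<inter> T' = {}" and un: "S \<union> T = S' \<union> T'"
      and t: "t \<in> carr (?p S \<otimes> ?p T)"
  proof -
    have fin': "finite S'" "finite T'" using fin un by (metis finite_Un)+
    \<comment> \<open>S lies in the union of S' and T', and likewise for the other three sets. These
      equalities turn the sources of the coproducts and the targets of the products on the
      intersections into S, T, S' and T'.\<close>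
    have eqs: "S \<inter> S' \<union> S \<inter> T' = S" "T \<inter> S' \<union> T \<inter> T' = T"
      "S \<inter> S' \<union> T \<inter> S' = S'" "S \<inter> T' \<union> T \<inter> T' = T'" using un by auto
    have \<Delta>S: "linear_map (?p S) (?p (S \<inter> S') \<otimes> ?p (S \<inter> T')) (PF_comult (S \<inter> S') (S \<inter> T'))"
      using PF_comult_linear[of "S \<inter> S'" "S \<inter> T'"] fin by (simp add: eqs)
    have \<Delta>T: "linear_map (?p T) (?p (T \<inter> S') \<otimes> ?p (T \<inter> T')) (PF_comult (T \<inter> S') (T \<inter> T'))"
      using PF_comult_linear[of "T \<inter> S'" "T \<inter> T'"] fin by (simp add: eqs)
    have "(S \<inter> S') \<inter> (T \<inter> S') = {}" "(S \<inter> T') \<inter> (T \<inter> T') = {}" using dis by auto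
    then have \<mu>S: "linear_map (?p (S \<inter> S') \<otimes> ?p (T \<inter> S')) (?p S') (PF_mult (S \<inter> S') (T \<inter> S'))"
      and \<mu>T: "linear_map (?p (S \<inter> T') \<otimes> ?p (T \<inter> T')) (?p T') (PF_mult (S \<inter> T') (T \<inter> T'))"
      using PF_mult_linear[of "S \<inter> S'" "T \<inter> S'"] PF_mult_linear[of "S \<inter> T'" "T \<inter> T'"] fin
      by (simp_all add: eqs)
    note f = linear_map_comp[OF PF_mult_linear[OF fin dis(1), unfolded un] PF_comult_linear[OF fin']]
    note g = linear_map_comp[OF tensor_map_linear[OF vspace_PF \<Delta>S \<Delta>T]
        linear_map_comp[OF tensor_interchange_linear[OF vspace_PF vspace_PF vspace_PF vspace_PF]
          tensor_map_linear[OF vspace_tensor \<mu>S \<mu>T]]]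
    \<comment> \<open>The right side restricts to intersections, the left side to S' or T'. Blocks
      of a parking function on A lie in A, so the two restrictions coincide.\<close>
    have Int: "restrict_comp \<Phi> (A \<inter> B) = restrict_comp \<Phi> B" if "\<Phi> \<in> PF A" for \<Phi> and A B :: "'a set"
      using restrict_Int PF_D(1)[OF that] by blast
    have PF: "park (restrict_comp \<Phi> B) \<in> PF (A \<inter> B)" if "\<Phi> \<in> PF A" "finite A" for \<Phi> and A B :: "'a set"
      using park_restrict_in_PF[OF that(2,1) Int_lower1[of A B]] by (simp only: Int[OF that(1)])
    show ?thesis
      by (rule PF_tensor_eqI[OF f g _ t])
         (simp add: PF_mult_basis fin PF_comult_basis park_restrict_append[OF fin(1)] Int
            tensor_map_pure[OF \<Delta>S \<Delta>T] tensor_map_pure[OF \<mu>S \<mu>T] tensor_interchange_pure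
            basis_in_PF_species PF pure_tensor_in del: restrict_comp_simps)
  qed
  show "PF_counit (PF_mult {} {} (pure_tensor (?p {}) (?p {}) x y)) = PF_counit x * PF_counit y"
    if x: "x \<in> carr (?p {})" and y: "y \<in> carr (?p {})"
  proof -
    \<comment> \<open>A pure tensor takes the value 0 by definition on functions that are not
      bilinear, so bilinearity must be known before it is evaluated.\<close>
    have "bilinear_form (?p {}) (?p {}) (\<lambda>u v. Poly_Mapping.lookup u [] * Poly_Mapping.lookup v [])"
      unfolding PF_species_def by (rule coordinate_form)
    then show ?thesis
      by (simp add: PF_mult_def PF_counit_def tensor_ext_def PF_empty pure_tensor_def)
  qed
  show "PF_comult {} {} (PF_unit 1) = pure_tensor (?p {}) (?p {}) (PF_unit 1) (PF_unit 1)"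
    by (simp add: PF_unit_1 PF_comult_basis)
  show "PF_counit (PF_unit 1 :: 'a set list \<Rightarrow>\<^sub>0 'k) = 1"
    by (simp add: PF_unit_1 PF_counit_nil)
qed


section \<open>The antipode\<close>

definition set_compositions :: "'a set \<Rightarrow> 'a set list set" where
  "set_compositions I = {C. weak_set_composition I C \<and> {} \<notin> set C}"

text \<open>The result of applying the iterated coproduct along C to the basis element \<Phi> and
  multiplying the pieces in order.\<close>

definition split_park :: "'a set list \<Rightarrow> 'a set list \<Rightarrow> 'a set list" where
  "split_park C \<Phi> = concat (map (\<lambda>S. park (restrict_comp \<Phi> S)) C)"

text \<open>For \<open>I = {}\<close> the only composition is the empty one, so the antipode is the
  identity there.\<close>

definition PF_antipode :: "'a set \<Rightarrow> ('a set list \<Rightarrow>\<^sub>0 'k::field) \<Rightarrow> 'a set list \<Rightarrow>\<^sub>0 'k" where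
  "PF_antipode I = lin_ext (scal (PF_species I))
     (\<lambda>\<Phi>. \<Sum>C\<in>set_compositions I. Poly_Mapping.single (split_park C \<Phi>) ((-1) ^ length C))"

lemma set_compositions_iff:
  "C \<in> set_compositions I \<longleftrightarrow> \<Union>(set C) = I \<and> disjoint_blocks C \<and> {} \<notin> set C"
  by (simp add: set_compositions_def weak_set_composition_iff)

lemma set_compositions_empty: "set_compositions {} = {[]}"
  by (auto simp: set_compositions_iff) (metis list.set_intros(1) neq_Nil_conv)

lemma finite_set_compositions:
  assumes "finite I"
  shows "finite (set_compositions I)"
proof (rule finite_subset)
  \<comment> \<open>Disjoint nonempty blocks cannot repeat, which bounds the length of a
    composition.\<close>
  have "distinct C" if "disjoint_blocks C" "{} \<notin> set C" for C :: "'a set list"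
    using that by (induction C) auto
  then show "set_compositions I \<subseteq> {C. set C \<subseteq> Pow I \<and> distinct C}"
    by (auto simp: set_compositions_iff)
  show "finite {C. set C \<subseteq> Pow I \<and> distinct C}"
    using assms by (intro finite_subset_distinct) simp
qed

lemma set_compositions_snoc:
  "C @ [B] \<in> set_compositions I \<longleftrightarrow> B \<noteq> {} \<and> B \<subseteq> I \<and> C \<in> set_compositions (I - B)"
  by (auto simp: set_compositions_iff sorted_wrt_append)

lemma set_compositions_Cons:
  "B # C \<in> set_compositions I \<longleftrightarrow> B \<noteq> {} \<and> B \<subseteq> I \<and> C \<in> set_compositions (I - B)"
  by (auto simp: set_compositions_iff)

lemma split_park_simps [simp]:
  "split_park [] \<Phi> = []" "split_park (B # C) \<Phi> = park (restrict_comp \<Phi> B) @ split_park C \<Phi>"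
  "split_park (C @ D) \<Phi> = split_park C \<Phi> @ split_park D \<Phi>"
  by (simp_all add: split_park_def)

text \<open>Formulated for families covering only part of I, because the induction removes a block
  while \<Phi> stays a parking function on all of I.\<close>

lemma split_park_in_PF:
  assumes "finite I" "\<Phi> \<in> PF I"
  shows "\<lbrakk>disjoint_blocks C; \<Union>(set C) \<subseteq> I\<rbrakk> \<Longrightarrow> split_park C \<Phi> \<in> PF (\<Union>(set C))"
proof (induction C)
  case (Cons B C)
  then have B: "B \<subseteq> I" and C: "\<Union>(set C) \<subseteq> I" and dis: "B \<inter> \<Union>(set C) = {}" by auto
  show ?case
    using append_in_PF[OF finite_subset[OF B assms(1)] finite_subset[OF C assms(1)] dis
        park_restrict_in_PF[OF assms B] Cons.IH[OF _ C]] Cons.prems by simp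
qed (simp add: PF_empty)

lemma split_park_PF:
  "\<lbrakk>finite I; \<Phi> \<in> PF I; C \<in> set_compositions I\<rbrakk> \<Longrightarrow> split_park C \<Phi> \<in> PF I"
  using split_park_in_PF[of I \<Phi> C] by (simp add: set_compositions_iff)

text \<open>By \<open>park_coassoc\<close> the splitting sees through an earlier parking, so the
  antipode of a coproduct factor can be written with the original \<Phi>.\<close>

lemma split_park_park:
  assumes "finite I" "\<Phi> \<in> PF I"
  shows "\<Union>(set C) \<subseteq> S \<Longrightarrow> split_park C (park (restrict_comp \<Phi> S)) = split_park C \<Phi>"
  by (induction C) (auto simp: park_coassoc[OF assms])

lemma split_park_relabel:
  assumes "inj_on \<sigma> I" "\<Phi> \<in> PF I"
  shows "\<Union>(set C) \<subseteq> I \<Longrightarrow> split_park (relabel \<sigma> C) (relabel \<sigma> \<Phi>) = relabel \<sigma> (split_park C \<Phi>)"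
  by (induction C) (auto simp: park_restrict_relabel[OF assms])

lemma set_compositions_relabel:
  assumes "inj_on \<sigma> I" "C \<in> set_compositions I"
  shows "relabel \<sigma> C \<in> set_compositions (\<sigma> ` I)"
proof -
  have "\<Union>(set (relabel \<sigma> C)) = \<sigma> ` \<Union>(set C)" by (auto simp: relabel_def)
  then show ?thesis
    using assms disjoint_blocks_relabel[of \<sigma> C] by (auto simp: set_compositions_iff relabel_def)
qed

lemma relabel_inv:
  assumes "inj_on \<sigma> I"
  shows "\<Union>(set \<Gamma>) \<subseteq> I \<Longrightarrow> relabel (inv_into I \<sigma>) (relabel \<sigma> \<Gamma>) = \<Gamma>"
  by (induction \<Gamma>) (auto simp: inv_into_image_cancel[OF assms])

lemma relabel_inv':
  "\<Union>(set \<Gamma>) \<subseteq> \<sigma> ` I \<Longrightarrow> relabel \<sigma> (relabel (inv_into I \<sigma>) \<Gamma>) = \<Gamma>"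
  by (induction \<Gamma>) (auto simp: image_inv_into_cancel[OF refl])

lemma sum_set_compositions_relabel:
  assumes "inj_on \<sigma> I"
  shows "(\<Sum>C\<in>set_compositions (\<sigma> ` I). h C) = (\<Sum>C\<in>set_compositions I. h (relabel \<sigma> C))"
proof (rule sum.reindex_bij_witness[where i = "relabel \<sigma>" and j = "relabel (inv_into I \<sigma>)"])
  fix C assume C: "C \<in> set_compositions (\<sigma> ` I)"
  show "relabel \<sigma> (relabel (inv_into I \<sigma>) C) = C"
    using C by (intro relabel_inv') (simp add: set_compositions_iff)
  then show "h (relabel \<sigma> (relabel (inv_into I \<sigma>) C)) = h C" by simp
  show "relabel (inv_into I \<sigma>) C \<in> set_compositions I"
    using set_compositions_relabel[OF inj_on_inv_into[OF order_refl] C] assms by simp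
next
  fix C assume C: "C \<in> set_compositions I"
  show "relabel (inv_into I \<sigma>) (relabel \<sigma> C) = C"
    using C by (intro relabel_inv[OF assms]) (simp add: set_compositions_iff)
  show "relabel \<sigma> C \<in> set_compositions (\<sigma> ` I)"
    by (rule set_compositions_relabel[OF assms C])
qed

section \<open>Linearity and naturality of the antipode\<close>

lemma single_in_PF_species: "\<Phi> \<in> PF I \<Longrightarrow> Poly_Mapping.single \<Phi> c \<in> carr (PF_species I)"
  by (simp add: PF_species_def free_vs_def)

lemma PF_antipode_linear:
  "finite I \<Longrightarrow> linear_map (PF_species I) (PF_species I) (PF_antipode I)"
  unfolding PF_antipode_def
  by (intro PF_lin_ext_linear vspace_PF vspace_sum single_in_PF_species split_park_PF)

lemma PF_antipode_basis:
  "PF_antipode I (basis \<Phi>) =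
     (\<Sum>C\<in>set_compositions I. Poly_Mapping.single (split_park C \<Phi>) ((-1) ^ length C))"
  by (simp add: PF_antipode_def PF_species_def lin_ext_basis vspace_free)

lemma PF_act_single:
  assumes "inj_on \<sigma> I" "\<Phi> \<in> PF I"
  shows "PF_act I \<sigma> (Poly_Mapping.single \<Phi> c) = Poly_Mapping.single (relabel \<sigma> \<Phi>) c"
  using linear_map_scale[OF PF_act_linear[OF assms(1)] basis_in_PF_species[OF assms(2)], of c]
  by (simp add: scal_PF PF_act_basis)

text \<open>Takeuchi's signs enter as coefficients; linearity in the first slot pulls them out of
  the product.\<close>

lemma PF_mult_single_left:
  assumes "finite S" "finite T" "S \<inter> T = {}" "\<Phi> \<in> PF S" "\<Psi> \<in> PF T"
  shows "PF_mult S T (pure_tensor (PF_species S) (PF_species T) (Poly_Mapping.single \<Phi> c) (basis \<Psi>))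
    = Poly_Mapping.single (\<Phi> @ \<Psi>) c"
  using linear_map_scale[OF linear_map_comp[OF
      pure_tensor_linear(2)[OF vspace_PF vspace_PF basis_in_PF_species[OF assms(5)]]
      PF_mult_linear[OF assms(1-3)]] basis_in_PF_species[OF assms(4)], of c]
  by (simp add: scal_PF PF_mult_basis assms)

lemma PF_mult_single_right:
  assumes "finite S" "finite T" "S \<inter> T = {}" "\<Phi> \<in> PF S" "\<Psi> \<in> PF T"
  shows "PF_mult S T (pure_tensor (PF_species S) (PF_species T) (basis \<Phi>) (Poly_Mapping.single \<Psi> c))
    = Poly_Mapping.single (\<Phi> @ \<Psi>) c"
  using linear_map_scale[OF linear_map_comp[OF
      pure_tensor_linear(1)[OF vspace_PF vspace_PF basis_in_PF_species[OF assms(4)]]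
      PF_mult_linear[OF assms(1-3)]] basis_in_PF_species[OF assms(5)], of c]
  by (simp add: scal_PF PF_mult_basis assms)

lemma PF_antipode_morphism:
  "species_morphism (PF_species :: 'a set \<Rightarrow> ('k::field, 'a set list \<Rightarrow>\<^sub>0 'k) vs) PF_act
     PF_species PF_act PF_antipode"
  unfolding species_morphism_def
proof (intro conjI allI impI ballI)
  fix I :: "'a set" and \<sigma> :: "'a \<Rightarrow> 'a" and x :: "'a set list \<Rightarrow>\<^sub>0 'k"
  assume fin: "finite I"
  show "linear_map (PF_species I) (PF_species I :: ('k, _) vs) (PF_antipode I)"
    by (rule PF_antipode_linear[OF fin])
  assume inj: "inj_on \<sigma> I" and x: "x \<in> carr (PF_species I)"
  note act = PF_act_linear[OF inj]
  show "PF_antipode (\<sigma> ` I) (PF_act I \<sigma> x) = PF_act I \<sigma> (PF_antipode I x)"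
  proof (rule PF_eqI[OF linear_map_comp[OF act PF_antipode_linear[OF finite_imageI[OF fin]]]
        linear_map_comp[OF PF_antipode_linear[OF fin] act] _ x])
    fix \<Phi> assume \<Phi>: "\<Phi> \<in> PF I"
    let ?s = "\<lambda>C. Poly_Mapping.single (split_park C \<Phi>) ((-1) ^ length C) :: 'a set list \<Rightarrow>\<^sub>0 'k"
    have s: "?s C \<in> carr (PF_species I)" if "C \<in> set_compositions I" for C
      using that by (intro single_in_PF_species split_park_PF fin \<Phi>)
    have "PF_act I \<sigma> (PF_antipode I (basis \<Phi>)) = (\<Sum>C\<in>set_compositions I. PF_act I \<sigma> (?s C))"
      unfolding PF_antipode_basis by (rule linear_map_sum[OF vspace_PF act s])
    \<comment> \<open>The sign is written with \<open>length (relabel \<sigma> C)\<close>, which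
      equals \<open>length C\<close>, so that the summand depends on
      \<open>relabel \<sigma> C\<close> only and the sum can be reindexed.\<close>
    also have "\<dots> = (\<Sum>C\<in>set_compositions I.
        Poly_Mapping.single (split_park (relabel \<sigma> C) (relabel \<sigma> \<Phi>)) ((-1) ^ length (relabel \<sigma> C)))"
    proof (rule sum.cong[OF refl])
      fix C assume C: "C \<in> set_compositions I"
      then have "\<Union>(set C) \<subseteq> I" by (simp add: set_compositions_iff)
      then show "PF_act I \<sigma> (?s C) =
          Poly_Mapping.single (split_park (relabel \<sigma> C) (relabel \<sigma> \<Phi>)) ((-1) ^ length (relabel \<sigma> C))"
        by (simp add: PF_act_single[OF inj split_park_PF[OF fin \<Phi> C]] split_park_relabel[OF inj \<Phi>])
    qed
    also have "\<dots> = PF_antipode (\<sigma> ` I) (basis (relabel \<sigma> \<Phi>))"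
      unfolding PF_antipode_basis by (rule sum_set_compositions_relabel[OF inj, symmetric])
    finally show "PF_antipode (\<sigma> ` I) (PF_act I \<sigma> (basis \<Phi>))
        = PF_act I \<sigma> (PF_antipode I (basis \<Phi>) :: 'a set list \<Rightarrow>\<^sub>0 'k)"
      by (simp only: PF_act_basis)
  qed
qed

text \<open>A composition of a nonempty set has a last block, and removing it leaves a composition
  of the rest S. That block is nonempty exactly if S is not I, hence the excluded index.\<close>

lemma sum_set_compositions_snoc:
  fixes h :: "'a set list \<Rightarrow> 'b::comm_monoid_add"
  assumes "finite I" "I \<noteq> {}"
  shows "(\<Sum>S\<in>Pow I - {I}. \<Sum>C\<in>set_compositions S. h (C @ [I - S])) = (\<Sum>C\<in>set_compositions I. h C)"
proof -
  have "(\<Sum>S\<in>Pow I - {I}. \<Sum>C\<in>set_compositions S. h (C @ [I - S]))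
      = (\<Sum>(S, C)\<in>Sigma (Pow I - {I}) set_compositions. h (C @ [I - S]))"
    using assms(1) by (intro sum.Sigma) (auto intro: finite_set_compositions finite_subset)
  also have "\<dots> = (\<Sum>C\<in>set_compositions I. h C)"
  proof (rule sum.reindex_bij_witness[where i = "\<lambda>C. (I - last C, butlast C)"
        and j = "\<lambda>(S, C). C @ [I - S]"])
    fix C assume C: "C \<in> set_compositions I"
    then have "C \<noteq> []" using assms(2) by (auto simp: set_compositions_iff)
    then obtain D B where D: "C = D @ [B]" by (metis append_butlast_last_id)
    show "(case (I - last C, butlast C) of (S, C) \<Rightarrow> C @ [I - S]) = C"
      "(I - last C, butlast C) \<in> Sigma (Pow I - {I}) set_compositions"
      using C unfolding D set_compositions_snoc by (auto simp: double_diff)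
  qed (auto simp: set_compositions_snoc double_diff)
  finally show ?thesis .
qed

text \<open>Here the first block is removed and S is that block itself, so the excluded index is the
  empty set.\<close>

lemma sum_set_compositions_Cons:
  fixes h :: "'a set list \<Rightarrow> 'b::comm_monoid_add"
  assumes "finite I" "I \<noteq> {}"
  shows "(\<Sum>S\<in>Pow I - {{}}. \<Sum>C\<in>set_compositions (I - S). h (S # C)) = (\<Sum>C\<in>set_compositions I. h C)"
proof -
  have "(\<Sum>S\<in>Pow I - {{}}. \<Sum>C\<in>set_compositions (I - S). h (S # C))
      = (\<Sum>(S, C)\<in>Sigma (Pow I - {{}}) (\<lambda>S. set_compositions (I - S)). h (S # C))"
    using assms(1) by (intro sum.Sigma) (auto intro: finite_set_compositions)
  also have "\<dots> = (\<Sum>C\<in>set_compositions I. h C)"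
  proof (rule sum.reindex_bij_witness[where i = "\<lambda>C. (hd C, tl C)" and j = "\<lambda>(S, C). S # C"])
    fix C assume C: "C \<in> set_compositions I"
    then have "C \<noteq> []" using assms(2) by (auto simp: set_compositions_iff)
    then obtain B D where D: "C = B # D" by (metis list.exhaust)
    show "(case (hd C, tl C) of (S, C) \<Rightarrow> S # C) = C"
      "(hd C, tl C) \<in> Sigma (Pow I - {{}}) (\<lambda>S. set_compositions (I - S))"
      using C unfolding D set_compositions_Cons by auto
  qed (auto simp: set_compositions_Cons)
  finally show ?thesis .
qed

text \<open>Coproduct and antipode together produce parks of parks; \<open>split_park_park\<close>
  rewrites them in terms of \<Phi> alone, which makes the terms for different S comparable.\<close>

lemma convolution_term_left:
  assumes "finite I" "\<Phi> \<in> PF I" "S \<subseteq> I"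
  shows "PF_mult S (I - S) (tensor_map (PF_species S) (PF_species (I - S)) (PF_antipode S) id
      (PF_comult S (I - S) (basis \<Phi>)))
    = (\<Sum>C\<in>set_compositions S.
        Poly_Mapping.single (split_park C \<Phi> @ park (restrict_comp \<Phi> (I - S))) ((-1) ^ length C :: 'k::field))"
proof -
  let ?a = "park (restrict_comp \<Phi> S)" and ?b = "park (restrict_comp \<Phi> (I - S))"
  let ?s = "\<lambda>C. Poly_Mapping.single (split_park C ?a) ((-1) ^ length C) :: 'a set list \<Rightarrow>\<^sub>0 'k"
  have fin: "finite S" "finite (I - S)" "S \<inter> (I - S) = {}" using assms finite_subset by auto
  have a: "?a \<in> PF S" and b: "?b \<in> PF (I - S)"
    using park_restrict_in_PF[OF assms(1,2)] assms(3) by auto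
  have s: "?s C \<in> carr (PF_species S)" if "C \<in> set_compositions S" for C
    using that by (intro single_in_PF_species split_park_PF fin a)
  have "PF_mult S (I - S) (tensor_map (PF_species S) (PF_species (I - S)) (PF_antipode S) id
      (PF_comult S (I - S) (basis \<Phi>)))
    = PF_mult S (I - S) (pure_tensor (PF_species S) (PF_species (I - S))
        (\<Sum>C\<in>set_compositions S. ?s C) (basis ?b))"
    by (simp add: PF_comult_basis tensor_map_pure[OF PF_antipode_linear[OF fin(1)] linear_map_id_fun]
        basis_in_PF_species a b PF_antipode_basis)
  also have "\<dots> = (\<Sum>C\<in>set_compositions S.
      PF_mult S (I - S) (pure_tensor (PF_species S) (PF_species (I - S)) (?s C) (basis ?b)))"
    by (rule linear_map_sum[OF vspace_PF linear_map_comp[OF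
          pure_tensor_linear(2)[OF vspace_PF vspace_PF basis_in_PF_species[OF b]]
          PF_mult_linear[OF fin]] s])
  also have "\<dots> = (\<Sum>C\<in>set_compositions S. Poly_Mapping.single (split_park C \<Phi> @ ?b) ((-1) ^ length C))"
    by (intro sum.cong refl)
       (simp add: PF_mult_single_left[OF fin split_park_PF[OF fin(1) a] b],
        simp add: split_park_park[OF assms(1,2)] set_compositions_iff)
  finally show ?thesis .
qed

lemma convolution_term_right:
  assumes "finite I" "\<Phi> \<in> PF I" "S \<subseteq> I"
  shows "PF_mult S (I - S) (tensor_map (PF_species S) (PF_species (I - S)) id (PF_antipode (I - S))
      (PF_comult S (I - S) (basis \<Phi>)))
    = (\<Sum>C\<in>set_compositions (I - S).
        Poly_Mapping.single (park (restrict_comp \<Phi> S) @ split_park C \<Phi>) ((-1) ^ length C :: 'k::field))"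
proof -
  let ?a = "park (restrict_comp \<Phi> S)" and ?b = "park (restrict_comp \<Phi> (I - S))"
  let ?s = "\<lambda>C. Poly_Mapping.single (split_park C ?b) ((-1) ^ length C) :: 'a set list \<Rightarrow>\<^sub>0 'k"
  have fin: "finite S" "finite (I - S)" "S \<inter> (I - S) = {}" using assms finite_subset by auto
  have a: "?a \<in> PF S" and b: "?b \<in> PF (I - S)"
    using park_restrict_in_PF[OF assms(1,2)] assms(3) by auto
  have s: "?s C \<in> carr (PF_species (I - S))" if "C \<in> set_compositions (I - S)" for C
    using that by (intro single_in_PF_species split_park_PF fin b)
  have "PF_mult S (I - S) (tensor_map (PF_species S) (PF_species (I - S)) id (PF_antipode (I - S))
      (PF_comult S (I - S) (basis \<Phi>)))
    = PF_mult S (I - S) (pure_tensor (PF_species S) (PF_species (I - S))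
        (basis ?a) (\<Sum>C\<in>set_compositions (I - S). ?s C))"
    by (simp add: PF_comult_basis tensor_map_pure[OF linear_map_id_fun PF_antipode_linear[OF fin(2)]]
        basis_in_PF_species a b PF_antipode_basis)
  also have "\<dots> = (\<Sum>C\<in>set_compositions (I - S).
      PF_mult S (I - S) (pure_tensor (PF_species S) (PF_species (I - S)) (basis ?a) (?s C)))"
    by (rule linear_map_sum[OF vspace_PF linear_map_comp[OF
          pure_tensor_linear(1)[OF vspace_PF vspace_PF basis_in_PF_species[OF a]]
          PF_mult_linear[OF fin]] s])
  also have "\<dots> = (\<Sum>C\<in>set_compositions (I - S). Poly_Mapping.single (?a @ split_park C \<Phi>) ((-1) ^ length C))"
    by (intro sum.cong refl)
       (simp add: PF_mult_single_right[OF fin a split_park_PF[OF fin(2) b]],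
        simp add: split_park_park[OF assms(1,2)] set_compositions_iff)
  finally show ?thesis .
qed

lemma PF_antipode_left:
  assumes "finite I" "I \<noteq> {}" "\<Phi> \<in> PF I"
  shows "(\<Sum>S\<in>Pow I. PF_mult S (I - S) (tensor_map (PF_species S) (PF_species (I - S)) (PF_antipode S) id
      (PF_comult S (I - S) (basis \<Phi> :: _ \<Rightarrow>\<^sub>0 'k::field)))) = 0"
proof -
  let ?h = "\<lambda>C. Poly_Mapping.single (split_park C \<Phi>) ((-1) ^ length C :: 'k)"
  let ?t = "\<lambda>S. \<Sum>C\<in>set_compositions S.
    Poly_Mapping.single (split_park C \<Phi> @ park (restrict_comp \<Phi> (I - S))) ((-1) ^ length C :: 'k)"
  have "(\<Sum>S\<in>Pow I. ?t S) = ?t I + (\<Sum>S\<in>Pow I - {I}. ?t S)"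
    using assms(1) by (intro sum.remove) auto
  \<comment> \<open>The right factor is absorbed as the last block of \<open>C @ [I - S]\<close>,
    whose extra length supplies the minus sign.\<close>
  also have "(\<Sum>S\<in>Pow I - {I}. ?t S) = (\<Sum>S\<in>Pow I - {I}. \<Sum>C\<in>set_compositions S. - ?h (C @ [I - S]))"
    by (simp add: single_uminus)
  also have "\<dots> = - (\<Sum>C\<in>set_compositions I. ?h C)"
    using sum_set_compositions_snoc[OF assms(1,2), of "\<lambda>C. - ?h C"] by (simp add: sum_negf)
  \<comment> \<open>For S = I the right factor parks a list of empty blocks, which gives the empty
    list.\<close>
  also have "?t I = (\<Sum>C\<in>set_compositions I. ?h C)"
    by (simp add: park_restrict_empty)
  finally have "(\<Sum>S\<in>Pow I. ?t S) = 0" by simp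
  then show ?thesis by (simp add: convolution_term_left[OF assms(1,3)])
qed

lemma PF_antipode_right:
  assumes "finite I" "I \<noteq> {}" "\<Phi> \<in> PF I"
  shows "(\<Sum>S\<in>Pow I. PF_mult S (I - S) (tensor_map (PF_species S) (PF_species (I - S)) id (PF_antipode (I - S))
      (PF_comult S (I - S) (basis \<Phi> :: _ \<Rightarrow>\<^sub>0 'k::field)))) = 0"
proof -
  let ?h = "\<lambda>C. Poly_Mapping.single (split_park C \<Phi>) ((-1) ^ length C :: 'k)"
  let ?t = "\<lambda>S. \<Sum>C\<in>set_compositions (I - S).
    Poly_Mapping.single (park (restrict_comp \<Phi> S) @ split_park C \<Phi>) ((-1) ^ length C :: 'k)"
  have "(\<Sum>S\<in>Pow I. ?t S) = ?t {} + (\<Sum>S\<in>Pow I - {{}}. ?t S)"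
    using assms(1) by (intro sum.remove) auto
  also have "(\<Sum>S\<in>Pow I - {{}}. ?t S) = (\<Sum>S\<in>Pow I - {{}}. \<Sum>C\<in>set_compositions (I - S). - ?h (S # C))"
    by (simp add: single_uminus)
  also have "\<dots> = - (\<Sum>C\<in>set_compositions I. ?h C)"
    using sum_set_compositions_Cons[OF assms(1,2), of "\<lambda>C. - ?h C"] by (simp add: sum_negf)
  also have "?t {} = (\<Sum>C\<in>set_compositions I. ?h C)"
    by (simp add: park_restrict_empty)
  finally have "(\<Sum>S\<in>Pow I. ?t S) = 0" by simp
  then show ?thesis by (simp add: convolution_term_right[OF assms(1,3)])
qed

theorem theorem4p7:
  shows "species_hopf_monoid
    (PF_species :: 'a set \<Rightarrow> ('k::field_char_0, 'a set list \<Rightarrow>\<^sub>0 'k) vs)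
    PF_act PF_mult PF_unit PF_comult PF_counit"
proof -
  let ?p = "PF_species :: 'a set \<Rightarrow> ('k, 'a set list \<Rightarrow>\<^sub>0 'k) vs"
  interpret species_bimonoid ?p PF_act PF_mult PF_unit PF_comult PF_counit
    by (rule PF_bimonoid)
  \<comment> \<open>Linearity reduces the two antipode equations to basis elements. The factors are
    assumed linear on subsets of I only, because \<open>PF_antipode_linear\<close> covers finite
    sets.\<close>
  have lin: "linear_map (?p I) (?p I) (convolution f g I)"
    if fin: "finite I" and f: "\<And>S. S \<subseteq> I \<Longrightarrow> linear_map (?p S) (?p S) (f S)"
      and g: "\<And>S. S \<subseteq> I \<Longrightarrow> linear_map (?p S) (?p S) (g S)" for f g I
    unfolding convolution_def
  proof (rule linear_map_sum_fun[OF vspace_PF])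
    fix S assume "S \<in> Pow I"
    then have S: "S \<subseteq> I" "finite S" "finite (I - S)" "S \<inter> (I - S) = {}" "S \<union> (I - S) = I"
      using fin finite_subset by auto
    note c = linear_map_comp[OF PF_comult_linear[OF S(2,3)] linear_map_comp[OF
          tensor_map_linear[OF vspace_PF f[OF S(1)] g[OF Diff_subset]] PF_mult_linear[OF S(2-4)]]]
    show "linear_map (?p I) (?p I) (\<lambda>x. PF_mult S (I - S)
        (tensor_map (?p S) (?p (I - S)) (f S) (g (I - S)) (PF_comult S (I - S) x)))"
      using c unfolding S(5) .
  qed
  have unit: "linear_map (?p I) (?p I) (convolution_unit I)" for I
    unfolding convolution_unit_def
    using linear_map_comp[OF PF_counit_linear PF_unit_linear] linear_map_zero_fun[of "?p I" "?p I"]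
    by (cases "I = {}") auto
  have "convolution PF_antipode (\<lambda>_. id) I x = convolution_unit I x \<and>
      convolution (\<lambda>_. id) PF_antipode I x = convolution_unit I x"
    if fin: "finite I" and x: "x \<in> carr (?p I)" for I x
  proof
    have s: "linear_map (?p S) (?p S) (PF_antipode S)" if "S \<subseteq> I" for S
      using PF_antipode_linear finite_subset[OF that fin] by blast
    have nil: "\<Phi> = []" if "\<Phi> \<in> PF {}" for \<Phi> :: "'a set list"
      using that by (simp add: PF_empty)
    show "convolution PF_antipode (\<lambda>_. id) I x = convolution_unit I x"
    proof (rule PF_eqI[OF lin[OF fin s linear_map_id_fun] unit _ x])
      fix \<Phi> :: "'a set list" assume \<Phi>: "\<Phi> \<in> PF I"
      show "convolution PF_antipode (\<lambda>_. id) I (basis \<Phi>) = convolution_unit I (basis \<Phi>)"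
      proof (cases "I = {}")
        case True
        \<comment> \<open>The only subset is empty and its only composition is the empty list, so
          the convolution is the single term \<open>basis []\<close>.\<close>
        then show ?thesis
          using convolution_term_left[of "{}" "[]" "{}", where 'k = 'k] nil \<Phi>
          by (simp add: convolution_def convolution_unit_def set_compositions_empty PF_empty
              PF_counit_nil PF_unit_1)
      qed (simp add: convolution_def convolution_unit_def PF_antipode_left fin \<Phi>)
    qed
    show "convolution (\<lambda>_. id) PF_antipode I x = convolution_unit I x"
    proof (rule PF_eqI[OF lin[OF fin linear_map_id_fun s] unit _ x])
      fix \<Phi> :: "'a set list" assume \<Phi>: "\<Phi> \<in> PF I"
      show "convolution (\<lambda>_. id) PF_antipode I (basis \<Phi>) = convolution_unit I (basis \<Phi>)"
      proof (cases "I = {}")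
        case True
        then show ?thesis
          using convolution_term_right[of "{}" "[]" "{}", where 'k = 'k] nil \<Phi>
          by (simp add: convolution_def convolution_unit_def set_compositions_empty PF_empty
              PF_counit_nil PF_unit_1)
      qed (simp add: convolution_def convolution_unit_def PF_antipode_right fin \<Phi>)
    qed
  qed
  then have "antipode PF_antipode"
    unfolding antipode_def using PF_antipode_morphism by blast
  then show ?thesis
    by unfold_locales blast
qed

end
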